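(* For every $\delta>0$ there is a constant $K_\delta>0$ such that for all integers $N\ge 1$, \[ \frac{1}{3\pi^2}N^4 - K_\delta N^{3+\delta} \;\le\; \#3\mathrm{iet}(N) \;\le\; \frac{2}{\pi^2}N^4 + K_\delta N^{3+\delta}. \]
   Context: For $\varepsilon\in(0,1)\setminus\mathbb{Q}$ and $\ell$ with $\max\{\varepsilon,1-\varepsilon\}<\ell<1$, define $T_{\varepsilon,\ell}:[0,\ell)\to[0,\ell)$ by $T_{\varepsilon,\ell}(x)=x+1-\varepsilon$ on $I_A=[0,\ell-1+\varepsilon)$, $T_{\varepsilon,\ell}(x)=x+1-2\varepsilon$ on $I_B=[\ell-1+\varepsilon,\varepsilon)$, and $T_{\varepsilon,\ell}(x)=x-\varepsilon$ on $I_C=[\varepsilon,\ell)$ (exchange of three intervals with permutation $(3,2,1)$). For $x_0\in[0,\ell)$, the 3iet word $u_{\varepsilon,\ell,x_0}=(u_n)_{n\in\mathbb{Z}}\in\{A,B,C\}^{\mathbb{Z}}$ is given by $u_n=X$ iff $T_{\varepsilon,\ell}^n(x_0)\in I_X$, $X\in\{A,B,C\}$. A 3iet factor is a finite word $u_iu_{i+1}\cdots u_{i+n-1}$ occurring in some 3iet word (for some admissible $\varepsilon,\ell,x_0$). $3\mathrm{iet}(N)$ denotes the set of all 3iet factors of length $N$. *)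

theory Defs
  imports "HOL-Analysis.Analysis"
begin

datatype letter = A | B | C

definition admissible :: "real \<Rightarrow> real \<Rightarrow> bool" where
  "admissible \<epsilon> l \<longleftrightarrow> 0 < \<epsilon> \<and> \<epsilon> < 1 \<and> \<epsilon> \<notin> \<rat> \<and> max \<epsilon> (1 - \<epsilon>) < l \<and> l < 1"

definition T3 :: "real \<Rightarrow> real \<Rightarrow> real \<Rightarrow> real" where
  "T3 \<epsilon> l x =
     (if 0 \<le> x \<and> x < l - 1 + \<epsilon> then x + 1 - \<epsilon>
      else if l - 1 + \<epsilon> \<le> x \<and> x < \<epsilon> then x + 1 - 2 * \<epsilon>
      else x - \<epsilon>)"

definition T3pow :: "real \<Rightarrow> real \<Rightarrow> int \<Rightarrow> real \<Rightarrow> real" where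
  "T3pow \<epsilon> l n x =
     (if 0 \<le> n then (T3 \<epsilon> l ^^ nat n) x
      else (the_inv_into {0..<l} (T3 \<epsilon> l) ^^ nat (- n)) x)"

definition code3 :: "real \<Rightarrow> real \<Rightarrow> real \<Rightarrow> letter" where
  "code3 \<epsilon> l x =
     (if 0 \<le> x \<and> x < l - 1 + \<epsilon> then A
      else if l - 1 + \<epsilon> \<le> x \<and> x < \<epsilon> then B
      else C)"

definition iet_word :: "real \<Rightarrow> real \<Rightarrow> real \<Rightarrow> int \<Rightarrow> letter" where
  "iet_word \<epsilon> l x0 n = code3 \<epsilon> l (T3pow \<epsilon> l n x0)"

definition iet3 :: "nat \<Rightarrow> letter list set" where
  "iet3 N = {w. \<exists>\<epsilon> l x0 i. admissible \<epsilon> l \<and> 0 \<le> x0 \<and> x0 < l \<and>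
                   w = map (\<lambda>k. iet_word \<epsilon> l x0 (i + int k)) [0..<N]}"

end

(* If w extends by both B and C, then by convexity in the parameters w can be realised so that its orbit
   ends exactly at the discontinuity epsilon. The exchange is induced on [0, l) by the rotation by
   -epsilon, so this orbit consists of fractional parts of j * epsilon with j = 1, ..., m = n + b + 1,
   and the b letters B mark the values of j for which that part is at least l. Hence w is determined by b
   and the integer parts of j * epsilon, that is, by the Farey interval of order m containing epsilon.
   The number of factors grows from n to n + 1 by twice the number of such words, because exchanging A
   and C is a symmetry. For the upper bound, the Farey interval is identified by the sum of the integer
   parts of j * epsilon, and b restricts epsilon to [b / (m + 1), 1 - b / m]; this gives N^4 / 6. For the
   lower bound, irrationals just to the right of reduced fractions with denominator at most m realise
   distinct words, and at least half of all pairs (p, q) are coprime; this gives N^4 / 24. Both constants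
   suffice since 8 <= pi^2 <= 12. *)
theory Submission
  imports Defs
begin

section \<open>Words read along an orbit\<close>

text \<open>The obstacle is irrationality: interpolating between two realisations of a word may
  produce a rational \<epsilon>. The language is therefore parametrised by a set \<open>E\<close> of
  angles. Over all reals, where convexity is available, the growth formula is an equality and gives
  the upper bound; over the irrationals only an inequality is proved, in the direction that the
  lower bound needs. The constants come from the same count for fixed b. With m = n + b + 1, the
  pairs (p, q) with q \<le> m and p / q between b / m and 1 - b / m number about m * (m - 2 * b) /
  2, that is, (n^2 - b^2) / 2. The upper bound keeps all of this: summing over b gives n^3 / 3, and
  twice the sum over n gives N^4 / 6. The lower bound loses a factor 2 by using only one of p / q
  and 1 - p / q, and another factor 2 through coprimality. The factor N^\<delta> is needed only in
  the lower bound, where the rounding errors over all common divisors add up to a harmonic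
  sum.\<close>

fun wt :: "letter \<Rightarrow> nat" where
  "wt A = 1" | "wt B = 2" | "wt C = 1"

fun up :: "letter \<Rightarrow> nat" where
  "up A = 1" | "up B = 1" | "up C = 0"

fun swap :: "letter \<Rightarrow> letter" where
  "swap A = C" | "swap B = B" | "swap C = A"

definition wts :: "letter list \<Rightarrow> nat" where
  "wts w = sum_list (map wt w)"

definition ups :: "letter list \<Rightarrow> nat" where
  "ups w = sum_list (map up w)"

text \<open>A letter stands for \<open>wt\<close> steps of the rotation by -\<epsilon>, during which
  \<open>up\<close> wraps past 0 occur. From the piece of B the first step lands in [l, 1), outside
  the domain, so a second one is made.\<close>

definition move :: "real \<Rightarrow> letter \<Rightarrow> real \<Rightarrow> real" where
  "move \<epsilon> a x = x + real (up a) - real (wt a) * \<epsilon>"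

definition final :: "real \<Rightarrow> letter list \<Rightarrow> real \<Rightarrow> real" where
  "final \<epsilon> w x = x + real (ups w) - real (wts w) * \<epsilon>"

fun piece :: "real \<Rightarrow> real \<Rightarrow> letter \<Rightarrow> real set" where
  "piece \<epsilon> l A = {0..<l - 1 + \<epsilon>}"
| "piece \<epsilon> l B = {l - 1 + \<epsilon>..<\<epsilon>}"
| "piece \<epsilon> l C = {\<epsilon>..<l}"

text \<open>Open pieces serve the two operations that half-open ones do not tolerate: small shifts
  in both directions, and reflection of the interval.\<close>

fun open_piece :: "real \<Rightarrow> real \<Rightarrow> letter \<Rightarrow> real set" where
  "open_piece \<epsilon> l A = {0<..<l - 1 + \<epsilon>}"
| "open_piece \<epsilon> l B = {l - 1 + \<epsilon><..<\<epsilon>}"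
| "open_piece \<epsilon> l C = {\<epsilon><..<l}"

fun follows :: "real \<Rightarrow> real \<Rightarrow> letter list \<Rightarrow> real \<Rightarrow> bool" where
  "follows \<epsilon> l [] x = True"
| "follows \<epsilon> l (a # w) x = (x \<in> piece \<epsilon> l a \<and> follows \<epsilon> l w (move \<epsilon> a x))"

fun sfollows :: "real \<Rightarrow> real \<Rightarrow> letter list \<Rightarrow> real \<Rightarrow> bool" where
  "sfollows \<epsilon> l [] x = True"
| "sfollows \<epsilon> l (a # w) x = (x \<in> open_piece \<epsilon> l a \<and> sfollows \<epsilon> l w (move \<epsilon> a x))"

definition adm :: "real \<Rightarrow> real \<Rightarrow> bool" where
  "adm \<epsilon> l \<longleftrightarrow> \<epsilon> < l \<and> 1 - \<epsilon> < l \<and> l < 1"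

text \<open>Irrationality is taken out of \<open>admissible\<close> and becomes the choice of
  \<open>E\<close>.\<close>

definition lang :: "real set \<Rightarrow> nat \<Rightarrow> letter list set" where
  "lang E n = {w. length w = n \<and>
     (\<exists>\<epsilon> l x. \<epsilon> \<in> E \<and> adm \<epsilon> l \<and> 0 \<le> x \<and> x < l \<and> follows \<epsilon> l w x)}"

lemma langI:
  "length w = n \<Longrightarrow> \<epsilon> \<in> E \<Longrightarrow> adm \<epsilon> l \<Longrightarrow> 0 \<le> x \<Longrightarrow> x < l \<Longrightarrow> follows \<epsilon> l w x \<Longrightarrow> w \<in> lang E n"
  unfolding lang_def by blast

lemma wts_simps [simp]: "wts [] = 0" "wts (a # w) = wt a + wts w"
  and ups_simps [simp]: "ups [] = 0" "ups (a # w) = up a + ups w"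
  by (simp_all add: wts_def ups_def)

lemma final_simps [simp]: "final \<epsilon> [] x = x" "final \<epsilon> (a # w) x = final \<epsilon> w (move \<epsilon> a x)"
  by (simp_all add: final_def move_def algebra_simps)

lemma wts_eq_length: "wts w = length w + count_list w B"
proof (induction w)
  case (Cons a w)
  then show ?case by (cases a) auto
qed simp

lemma admissible_iff: "admissible \<epsilon> l \<longleftrightarrow> adm \<epsilon> l \<and> \<epsilon> \<in> - \<rat>"
  by (auto simp: admissible_def adm_def)

lemma follows_snoc: "follows \<epsilon> l (w @ [a]) x \<longleftrightarrow> follows \<epsilon> l w x \<and> final \<epsilon> w x \<in> piece \<epsilon> l a"
  by (induction w arbitrary: x) auto

lemma sfollows_imp_follows: "sfollows \<epsilon> l w x \<Longrightarrow> follows \<epsilon> l w x"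
proof (induction w arbitrary: x)
  case (Cons a w)
  then show ?case by (cases a) auto
qed simp

lemma move_range:
  assumes "adm \<epsilon> l" "x \<in> piece \<epsilon> l a"
  shows "0 \<le> move \<epsilon> a x" "move \<epsilon> a x < l"
  using assms by (cases a; auto simp: adm_def move_def)+

lemma final_range:
  assumes "adm \<epsilon> l" "follows \<epsilon> l w x" "0 \<le> x" "x < l"
  shows "0 \<le> final \<epsilon> w x" "final \<epsilon> w x < l"
  using assms by (induction w arbitrary: x) (auto simp: move_range)

lemma ex_piece:
  assumes "adm \<epsilon> l" "0 \<le> x" "x < l"
  shows "\<exists>a. x \<in> piece \<epsilon> l a"
proof -
  have "x \<in> piece \<epsilon> l A \<or> x \<in> piece \<epsilon> l B \<or> x \<in> piece \<epsilon> l C"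
    using assms by (auto simp: adm_def)
  then show ?thesis by blast
qed

lemma finite_words: "finite {w :: letter list. length w = n}"
proof -
  have "(UNIV :: letter set) = {A, B, C}"
    using letter.exhaust by blast
  then have "finite (UNIV :: letter set)"
    by (metis finite.emptyI finite.insertI)
  then have "finite {w :: letter list. set w \<subseteq> UNIV \<and> length w = n}"
    by (rule finite_lists_length_eq)
  then show ?thesis by simp
qed

lemma finite_lang: "finite (lang E n)"
  by (rule finite_subset[OF _ finite_words[of n]]) (auto simp: lang_def)

subsection \<open>Orbits of the exchange\<close>

lemma code3_eq_iff:
  assumes "adm \<epsilon> l" "0 \<le> x" "x < l"
  shows "code3 \<epsilon> l x = a \<longleftrightarrow> x \<in> piece \<epsilon> l a"
  using assms by (cases a) (auto simp: code3_def adm_def)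

lemma T3_eq_move:
  assumes "adm \<epsilon> l" "x \<in> piece \<epsilon> l a"
  shows "T3 \<epsilon> l x = move \<epsilon> a x"
  using assms by (cases a) (auto simp: T3_def move_def adm_def)

lemma bij_T3:
  assumes "adm \<epsilon> l"
  shows "bij_betw (T3 \<epsilon> l) {0..<l} {0..<l}"
proof -
  \<comment> \<open>The images of the pieces C, B, A are [0, l - \<epsilon>), [l - \<epsilon>, 1 -
    \<epsilon>) and [1 - \<epsilon>, l), in this order; \<open>g\<close> inverts each
    branch.\<close>
  define g where "g y = (if y < l - \<epsilon> then y + \<epsilon> else if y < 1 - \<epsilon> then y + 2 * \<epsilon> - 1 else y + \<epsilon> - 1)" for y
  show ?thesis
    by (rule bij_betw_byWitness[where f' = g])
       (use assms in \<open>auto simp: T3_def g_def adm_def\<close>)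
qed

lemma follows_iff_map:
  assumes "adm \<epsilon> l" "0 \<le> x" "x < l"
  shows "follows \<epsilon> l w x \<longleftrightarrow> w = map (\<lambda>k. code3 \<epsilon> l ((T3 \<epsilon> l ^^ k) x)) [0..<length w]"
  using assms(2,3)
proof (induction w arbitrary: x)
  case (Cons a w)
  have *: "map (\<lambda>k. code3 \<epsilon> l ((T3 \<epsilon> l ^^ k) x)) [0..<length (a # w)] =
     code3 \<epsilon> l x # map (\<lambda>k. code3 \<epsilon> l ((T3 \<epsilon> l ^^ k) (T3 \<epsilon> l x))) [0..<length w]"
    by (simp add: map_upt_Suc funpow_swap1 del: upt_Suc)
  show ?case
  proof (cases "x \<in> piece \<epsilon> l a")
    case True
    then have "code3 \<epsilon> l x = a" "T3 \<epsilon> l x = move \<epsilon> a x"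
      using code3_eq_iff[OF assms(1)] T3_eq_move[OF assms(1)] Cons.prems by auto
    then show ?thesis
      unfolding * using True Cons.IH[of "move \<epsilon> a x"] move_range[OF assms(1) True] by simp
  next
    case False
    then have "code3 \<epsilon> l x \<noteq> a"
      using code3_eq_iff[OF assms(1)] Cons.prems by auto
    then show ?thesis
      unfolding * using False by auto
  qed
qed simp

lemma T3pow_step:
  assumes "adm \<epsilon> l" "0 \<le> x" "x < l"
  shows "T3pow \<epsilon> l i x \<in> {0..<l}" "T3pow \<epsilon> l (i + 1) x = T3 \<epsilon> l (T3pow \<epsilon> l i x)"
proof -
  let ?U = "the_inv_into {0..<l} (T3 \<epsilon> l)"
  note bij = bij_T3[OF assms(1)]
  have T: "T3 \<epsilon> l y \<in> {0..<l}" if "y \<in> {0..<l}" for y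
    using bij that by (rule bij_betw_apply)
  have U: "?U y \<in> {0..<l}" "T3 \<epsilon> l (?U y) = y" if "y \<in> {0..<l}" for y
    using bij_betw_apply[OF bij_betw_the_inv_into[OF bij]] f_the_inv_into_f_bij_betw[OF bij] that
    by auto
  have x: "x \<in> {0..<l}" using assms by simp
  have powT: "(T3 \<epsilon> l ^^ k) x \<in> {0..<l}" for k
    using x T by (induction k) auto
  have powU: "(?U ^^ k) x \<in> {0..<l}" for k
    using x U by (induction k) auto
  show "T3pow \<epsilon> l i x \<in> {0..<l}"
    unfolding T3pow_def using powT powU by (simp split: if_splits)
  show "T3pow \<epsilon> l (i + 1) x = T3 \<epsilon> l (T3pow \<epsilon> l i x)"
  proof (cases "0 \<le> i")
    case True
    then show ?thesis by (simp add: T3pow_def nat_add_distrib)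
  next
    case False
    define k where "k = nat (- i - 1)"
    have k: "nat (- i) = Suc k" "i + 1 = - int k" using False by (auto simp: k_def)
    have "T3pow \<epsilon> l (i + 1) x = (?U ^^ k) x"
      by (cases "k = 0") (auto simp: T3pow_def k(2))
    moreover have "T3pow \<epsilon> l i x = ?U ((?U ^^ k) x)"
      using False k by (simp add: T3pow_def)
    ultimately show ?thesis using U(2)[OF powU[of k]] by simp
  qed
qed

text \<open>A factor starting at position i, possibly negative, is read forwards from the i-th orbit
  point, which again lies in [0, l). So two-sided words have no other factors than forward
  orbits.\<close>

lemma iet3_eq_lang: "iet3 N = lang (- \<rat>) N"
proof (intro equalityI subsetI)
  fix w assume "w \<in> iet3 N"
  then obtain \<epsilon> l x i where *: "admissible \<epsilon> l" "0 \<le> x" "x < l"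
    "w = map (\<lambda>k. iet_word \<epsilon> l x (i + int k)) [0..<N]"
    by (auto simp: iet3_def)
  have a: "adm \<epsilon> l" "\<epsilon> \<in> - \<rat>" using *(1) by (auto simp: admissible_iff)
  let ?y = "T3pow \<epsilon> l i x"
  have y: "0 \<le> ?y" "?y < l" using T3pow_step(1)[OF a(1) *(2,3), of i] by auto
  have "T3pow \<epsilon> l (i + int k) x = (T3 \<epsilon> l ^^ k) ?y" for k
  proof (induction k)
    case (Suc k)
    then show ?case using T3pow_step(2)[OF a(1) *(2,3), of "i + int k"] by (simp add: ac_simps)
  qed simp
  then have "w = map (\<lambda>k. code3 \<epsilon> l ((T3 \<epsilon> l ^^ k) ?y)) [0..<length w]"
    using *(4) by (simp add: iet_word_def)
  then have "follows \<epsilon> l w ?y" using follows_iff_map[OF a(1) y] by blast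
  then show "w \<in> lang (- \<rat>) N"
    unfolding lang_def using a y *(4) by auto
next
  fix w assume "w \<in> lang (- \<rat>) N"
  then obtain \<epsilon> l x where *: "length w = N" "\<epsilon> \<in> - \<rat>" "adm \<epsilon> l" "0 \<le> x" "x < l" "follows \<epsilon> l w x"
    by (auto simp: lang_def)
  have "w = map (\<lambda>k. iet_word \<epsilon> l x (0 + int k)) [0..<N]"
    using follows_iff_map[OF *(3-5), of w] * by (simp add: iet_word_def T3pow_def)
  then show "w \<in> iet3 N"
    unfolding iet3_def using * admissible_iff by blast
qed

section \<open>Special factors\<close>

lemma sfollows_near:
  "sfollows \<epsilon> l w x \<Longrightarrow> \<exists>d>0. \<forall>t. \<bar>t\<bar> < d \<longrightarrow> sfollows \<epsilon> l w (x + t)"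
proof (induction w arbitrary: x)
  case Nil
  show ?case by (auto intro: exI[of _ 1])
next
  case (Cons a w)
  then obtain d where d: "d > 0" "\<And>t. \<bar>t\<bar> < d \<Longrightarrow> sfollows \<epsilon> l w (move \<epsilon> a x + t)" by auto
  have "open (open_piece \<epsilon> l a)" by (cases a) auto
  then obtain e where e: "e > 0" "\<And>y. dist y x < e \<Longrightarrow> y \<in> open_piece \<epsilon> l a"
    using Cons.prems unfolding open_dist by auto
  have "sfollows \<epsilon> l (a # w) (x + t)" if "\<bar>t\<bar> < min d e" for t
    using that d(2)[of t] e(2)[of "x + t"] by (simp add: dist_real_def move_def algebra_simps)
  then show ?case using d(1) e(1) by (intro exI[of _ "min d e"]) auto
qed

text \<open>Pieces are closed on the left and open on the right, so a small shift to the right moves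
  every orbit point into the interior of its piece.\<close>

lemma follows_right:
  "follows \<epsilon> l w x \<Longrightarrow> \<exists>d>0. \<forall>t. 0 < t \<and> t < d \<longrightarrow> sfollows \<epsilon> l w (x + t)"
proof (induction w arbitrary: x)
  case Nil
  show ?case by (auto intro: exI[of _ 1])
next
  case (Cons a w)
  then have "follows \<epsilon> l w (move \<epsilon> a x)" by simp
  from Cons.IH[OF this]
  obtain d where d: "d > 0" "\<And>t. 0 < t \<Longrightarrow> t < d \<Longrightarrow> sfollows \<epsilon> l w (move \<epsilon> a x + t)" by blast
  have "\<exists>e>0. \<forall>t. 0 < t \<and> t < e \<longrightarrow> x + t \<in> open_piece \<epsilon> l a"
  proof (cases a)
    case A
    then show ?thesis using Cons.prems by (intro exI[of _ "l - 1 + \<epsilon> - x"]) auto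
  next
    case B
    then show ?thesis using Cons.prems by (intro exI[of _ "\<epsilon> - x"]) auto
  next
    case C
    then show ?thesis using Cons.prems by (intro exI[of _ "l - x"]) auto
  qed
  then obtain e where e: "e > 0" "\<And>t. 0 < t \<Longrightarrow> t < e \<Longrightarrow> x + t \<in> open_piece \<epsilon> l a" by blast
  have "sfollows \<epsilon> l (a # w) (x + t)" if "0 < t" "t < min d e" for t
    using that d(2)[of t] e(2)[of t] by (simp add: move_def algebra_simps)
  then show ?case using d(1) e(1) by (intro exI[of _ "min d e"]) auto
qed

text \<open>The reflection of [0, l] conjugates the exchange for \<epsilon> to the one for 1 -
  \<epsilon>, without reversing time. It would turn half-open pieces the wrong way round, hence the
  strict version.\<close>

lemma sfollows_swap: "sfollows \<epsilon> l w x \<Longrightarrow> sfollows (1 - \<epsilon>) l (map swap w) (l - x)"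
proof (induction w arbitrary: x)
  case (Cons a w)
  have "l - x \<in> open_piece (1 - \<epsilon>) l (swap a)"
    using Cons.prems by (cases a) auto
  moreover have "move (1 - \<epsilon>) (swap a) (l - x) = l - move \<epsilon> a x"
    by (cases a) (auto simp: move_def algebra_simps)
  ultimately show ?case using Cons by auto
qed simp

lemma swap_swap [simp]: "swap (swap a) = a"
  by (cases a) auto

lemma swap_comp_swap [simp]: "swap \<circ> swap = id"
  by auto

lemma lang_swap:
  assumes "\<And>\<epsilon>. \<epsilon> \<in> E \<Longrightarrow> 1 - \<epsilon> \<in> E" and "w \<in> lang E n"
  shows "map swap w \<in> lang E n"
proof -
  obtain \<epsilon> l x where *: "length w = n" "\<epsilon> \<in> E" "adm \<epsilon> l" "0 \<le> x" "x < l" "follows \<epsilon> l w x"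
    using assms(2) by (auto simp: lang_def)
  obtain d where d: "d > 0" "\<And>t. 0 < t \<Longrightarrow> t < d \<Longrightarrow> sfollows \<epsilon> l w (x + t)"
    using follows_right[OF *(6)] by blast
  \<comment> \<open>The starting point is first nudged into the interior, so that the word is
    followed strictly and the reflected point stays in the domain.\<close>
  define t where "t = min d (l - x) / 2"
  have t: "0 < t" "t < d" "t < l - x" using d * by (auto simp: t_def)
  have "follows (1 - \<epsilon>) l (map swap w) (l - (x + t))"
    using d(2)[OF t(1,2)] by (intro sfollows_imp_follows sfollows_swap)
  moreover have "adm (1 - \<epsilon>) l" using *(3) by (auto simp: adm_def)
  moreover have "0 \<le> l - (x + t)" "l - (x + t) < l" using t * by auto
  ultimately show ?thesis
    using *(1) assms(1)[OF *(2)] by (intro langI) auto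
qed

section \<open>Right extensions and the growth of the language\<close>

definition ext :: "real set \<Rightarrow> nat \<Rightarrow> letter \<Rightarrow> letter list set" where
  "ext E n a = {w. w @ [a] \<in> lang E (Suc n)}"

text \<open>B and C are the pieces on the two sides of \<epsilon>. The pair A, B at the other
  discontinuity is the mirror image of this one.\<close>

definition special :: "real set \<Rightarrow> nat \<Rightarrow> letter list set" where
  "special E n = ext E n B \<inter> ext E n C"

lemma ext_iff:
  "w \<in> ext E n a \<longleftrightarrow> length w = n \<and> (\<exists>\<epsilon> l x. \<epsilon> \<in> E \<and> adm \<epsilon> l \<and> 0 \<le> x \<and> x < l \<and>
     follows \<epsilon> l w x \<and> final \<epsilon> w x \<in> piece \<epsilon> l a)"
  unfolding ext_def lang_def by (simp add: follows_snoc)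

lemma lang_SucD: "w @ [a] \<in> lang E (Suc n) \<Longrightarrow> w \<in> lang E n"
  by (auto simp: lang_def follows_snoc)

lemma Un_ext: "ext E n A \<union> ext E n B \<union> ext E n C = lang E n"
proof (intro equalityI subsetI)
  fix w assume "w \<in> lang E n"
  then obtain \<epsilon> l x where *: "length w = n" "\<epsilon> \<in> E" "adm \<epsilon> l" "0 \<le> x" "x < l" "follows \<epsilon> l w x"
    by (auto simp: lang_def)
  obtain a where "final \<epsilon> w x \<in> piece \<epsilon> l a"
    using ex_piece[OF *(3) final_range[OF *(3,6,4,5)]] by blast
  then have "w \<in> ext E n a"
    unfolding ext_def lang_def using * by (auto simp: follows_snoc)
  then show "w \<in> ext E n A \<union> ext E n B \<union> ext E n C" by (cases a) auto
qed (auto simp: ext_def dest: lang_SucD)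

lemma finite_ext: "finite (ext E n a)"
  using finite_lang[of E n] by (rule rev_finite_subset) (auto simp: ext_def dest: lang_SucD)

lemma card_lang_Suc:
  "card (lang E (Suc n)) = card (ext E n A) + card (ext E n B) + card (ext E n C)"
proof -
  let ?g = "\<lambda>a w. w @ [a :: letter]"
  have eq: "lang E (Suc n) = ?g A ` ext E n A \<union> (?g B ` ext E n B \<union> ?g C ` ext E n C)"
  proof (intro equalityI subsetI)
    fix w assume w: "w \<in> lang E (Suc n)"
    then have "w \<noteq> []" by (auto simp: lang_def)
    then obtain v a where "w = v @ [a]" by (cases w rule: rev_cases) auto
    then show "w \<in> ?g A ` ext E n A \<union> (?g B ` ext E n B \<union> ?g C ` ext E n C)"
      using w by (cases a) (auto simp: ext_def)
  qed (auto simp: ext_def)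
  have c: "card (?g a ` ext E n a) = card (ext E n a)" for a
    by (rule card_image) (auto simp: inj_on_def)
  have "card (?g B ` ext E n B \<union> ?g C ` ext E n C) = card (ext E n B) + card (ext E n C)"
    by (subst card_Un_disjoint) (auto simp: finite_ext c)
  moreover have "card (lang E (Suc n)) =
      card (ext E n A) + card (?g B ` ext E n B \<union> ?g C ` ext E n C)"
    unfolding eq by (subst card_Un_disjoint) (auto simp: finite_ext c)
  ultimately show ?thesis by simp
qed

lemma card_ext_swap:
  assumes "\<And>\<epsilon>. \<epsilon> \<in> E \<Longrightarrow> 1 - \<epsilon> \<in> E"
  shows "card (ext E n A \<inter> ext E n B) = card (special E n)"
proof (rule bij_betw_same_card)
  have "map swap w \<in> ext E n (swap a)" if "w \<in> ext E n a" for w a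
    using lang_swap[OF assms, where w = "w @ [a]" and n = "Suc n"] that by (simp add: ext_def)
  from this[of _ A] this[of _ B] this[of _ C]
  show "bij_betw (map swap) (ext E n A \<inter> ext E n B) (special E n)"
    by (intro bij_betw_byWitness[where f' = "map swap"]) (auto simp: special_def)
qed

lemma card_Un3:
  fixes X Y Z :: "'a set"
  assumes "finite X" "finite Y" "finite Z"
  shows "card X + card Y + card Z + card (X \<inter> Y \<inter> Z) =
         card (X \<union> Y \<union> Z) + card (X \<inter> Y) + card (Y \<inter> Z) + card (X \<inter> Z)"
proof -
  have "(X \<union> Y) \<inter> Z = (X \<inter> Z) \<union> (Y \<inter> Z)" "(X \<inter> Z) \<inter> (Y \<inter> Z) = X \<inter> Y \<inter> Z" by auto
  with card_Un_Int[of X Y] card_Un_Int[of "X \<union> Y" Z] card_Un_Int[of "X \<inter> Z" "Y \<inter> Z"] assms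
  show ?thesis by simp
qed

text \<open>In the inclusion-exclusion formula for the three extension sets, the triple intersection
  is at most the intersection for A and C. Those for A, B and for B, C then remain, and they have
  the same size by symmetry.\<close>

lemma card_lang_Suc_ge:
  assumes "\<And>\<epsilon>. \<epsilon> \<in> E \<Longrightarrow> 1 - \<epsilon> \<in> E"
  shows "card (lang E n) + 2 * card (special E n) \<le> card (lang E (Suc n))"
proof -
  have "card (ext E n A \<inter> ext E n B \<inter> ext E n C) \<le> card (ext E n A \<inter> ext E n C)"
    by (intro card_mono) (auto simp: finite_ext)
  then show ?thesis
    using card_Un3[OF finite_ext finite_ext finite_ext, of E n A E n B E n C]
      card_lang_Suc[of E n] card_ext_swap[of E n, OF assms]
    by (simp add: Un_ext special_def)
qed

text \<open>For a fixed word, all orbit points and all ends of pieces are affine in (\<epsilon>, l,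
  x), so following the word is a system of linear inequalities.\<close>

lemma follows_convex:
  assumes "follows \<epsilon> l w x" "follows \<epsilon>' l' w x'" "0 \<le> s" "s \<le> (1::real)"
  shows "follows ((1 - s) * \<epsilon> + s * \<epsilon>') ((1 - s) * l + s * l') w ((1 - s) * x + s * x')"
  using assms(1,2)
proof (induction w arbitrary: x x')
  case (Cons a w)
  have lt: "(1 - s) * u + s * u' < (1 - s) * v + s * v'" if "u < v" "u' < v'" for u v u' v' :: real
    using assms(3,4) that
    by (cases "s = 0") (auto intro!: add_le_less_mono mult_left_mono)
  have le: "(1 - s) * u + s * u' \<le> (1 - s) * v + s * v'" if "u \<le> v" "u' \<le> v'" for u v u' v' :: real
    using assms(3,4) that by (intro add_mono mult_left_mono) auto
  let ?e = "(1 - s) * \<epsilon> + s * \<epsilon>'" and ?l = "(1 - s) * l + s * l'" and ?x = "(1 - s) * x + s * x'"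
  have aff: "?l - 1 + ?e = (1 - s) * (l - 1 + \<epsilon>) + s * (l' - 1 + \<epsilon>')"
    by (simp add: algebra_simps)
  have "?x \<in> piece ?e ?l a"
  proof (cases a)
    case A
    then show ?thesis using Cons.prems lt[of x "l - 1 + \<epsilon>" x' "l' - 1 + \<epsilon>'"] le[of 0 x 0 x']
      by (simp add: aff)
  next
    case B
    then show ?thesis using Cons.prems lt[of x "\<epsilon>" x' "\<epsilon>'"] le[of "l - 1 + \<epsilon>" x "l' - 1 + \<epsilon>'" x']
      by (simp add: aff)
  next
    case C
    then show ?thesis using Cons.prems lt[of x l x' l'] le[of "\<epsilon>" x "\<epsilon>'" x'] by simp
  qed
  moreover have "move ?e a ?x = (1 - s) * move \<epsilon> a x + s * move \<epsilon>' a x'"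
    by (simp add: move_def algebra_simps)
  ultimately show ?case using Cons by simp
qed simp

text \<open>The value c = 0 gives the discontinuity \<epsilon> and c = 1 gives l - 1 + \<epsilon>.
  Along the segment between the two realisations, the distance of the end point from the
  discontinuity is affine and changes sign; \<open>s\<close> is its zero.\<close>

lemma follows_interpolate:
  assumes "adm \<epsilon> l" "0 \<le> x" "x < l" "follows \<epsilon> l w x"
    and "adm \<epsilon>' l'" "0 \<le> x'" "x' < l'" "follows \<epsilon>' l' w x'"
    and "final \<epsilon> w x < c * (l - 1) + \<epsilon>" "c * (l' - 1) + \<epsilon>' \<le> final \<epsilon>' w x'"
  shows "\<exists>\<epsilon> l x. adm \<epsilon> l \<and> 0 \<le> x \<and> x < l \<and> follows \<epsilon> l w x \<and> final \<epsilon> w x = c * (l - 1) + \<epsilon>"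
proof -
  define g where "g = c * (l - 1) + \<epsilon> - final \<epsilon> w x"
  define h where "h = final \<epsilon>' w x' - (c * (l' - 1) + \<epsilon>')"
  define s where "s = g / (g + h)"
  have gh: "g > 0" "h \<ge> 0" using assms by (auto simp: g_def h_def)
  have s: "0 \<le> s" "s \<le> 1" using gh by (auto simp: s_def)
  have z: "(1 - s) * g = s * h" using gh by (simp add: s_def field_simps)
  have lt: "(1 - s) * u + s * u' < (1 - s) * v + s * v'" if "u < v" "u' < v'" for u v u' v' :: real
    using s that by (cases "s = 0") (auto intro!: add_le_less_mono mult_left_mono)
  let ?e = "(1 - s) * \<epsilon> + s * \<epsilon>'" and ?l = "(1 - s) * l + s * l'" and ?x = "(1 - s) * x + s * x'"
  have "adm ?e ?l"
    using lt[of \<epsilon> l \<epsilon>' l'] lt[of "1 - \<epsilon>" l "1 - \<epsilon>'" l'] lt[of l 1 l' 1] assms(1,5)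
    by (simp add: adm_def algebra_simps)
  moreover have "0 \<le> ?x" "?x < ?l" using lt[of x l x' l'] assms s by auto
  moreover have "follows ?e ?l w ?x" using follows_convex assms s by blast
  moreover have "final ?e w ?x = c * (?l - 1) + ?e"
    using z by (simp add: g_def h_def final_def algebra_simps)
  ultimately show ?thesis by blast
qed

text \<open>Between an ending in A and one in C some realisation ends at l - 1 + \<epsilon>, the
  left end of the piece of B, which belongs to it.\<close>

lemma ext_A_C_imp_B: "ext UNIV n A \<inter> ext UNIV n C \<subseteq> ext UNIV n B"
proof
  fix w assume w: "w \<in> ext UNIV n A \<inter> ext UNIV n C"
  obtain \<epsilon> l x where 1: "length w = n" "adm \<epsilon> l" "0 \<le> x" "x < l" "follows \<epsilon> l w x"
    "final \<epsilon> w x \<in> piece \<epsilon> l A"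
    using w unfolding Int_iff ext_iff by blast
  obtain \<epsilon>' l' x' where 2: "adm \<epsilon>' l'" "0 \<le> x'" "x' < l'" "follows \<epsilon>' l' w x'"
    "final \<epsilon>' w x' \<in> piece \<epsilon>' l' C"
    using w unfolding Int_iff ext_iff by blast
  have "final \<epsilon> w x < 1 * (l - 1) + \<epsilon>" "1 * (l' - 1) + \<epsilon>' \<le> final \<epsilon>' w x'"
    using 1(6) 2(1,5) by (auto simp: adm_def)
  from follows_interpolate[OF 1(2-5) 2(1-4) this]
  obtain e m y where 3: "adm e m" "0 \<le> y" "y < m" "follows e m w y" "final e w y = 1 * (m - 1) + e"
    by blast
  then have "final e w y \<in> piece e m B" by (auto simp: adm_def)
  then show "w \<in> ext UNIV n B" using 1(1) 3 unfolding ext_iff by blast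
qed

lemma special_imp_hits:
  assumes "w \<in> special UNIV n"
  shows "length w = n \<and> (\<exists>\<epsilon> l x. adm \<epsilon> l \<and> follows \<epsilon> l w x \<and> final \<epsilon> w x = \<epsilon>)"
proof -
  obtain \<epsilon> l x where 1: "length w = n" "adm \<epsilon> l" "0 \<le> x" "x < l" "follows \<epsilon> l w x"
    "final \<epsilon> w x \<in> piece \<epsilon> l B"
    using assms unfolding special_def Int_iff ext_iff by blast
  obtain \<epsilon>' l' x' where 2: "adm \<epsilon>' l'" "0 \<le> x'" "x' < l'" "follows \<epsilon>' l' w x'"
    "final \<epsilon>' w x' \<in> piece \<epsilon>' l' C"
    using assms unfolding special_def Int_iff ext_iff by blast
  have "final \<epsilon> w x < 0 * (l - 1) + \<epsilon>" "0 * (l' - 1) + \<epsilon>' \<le> final \<epsilon>' w x'"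
    using 1(6) 2(5) by auto
  from follows_interpolate[OF 1(2-5) 2(1-4) this] show ?thesis using 1(1) by auto
qed

lemma card_lang_UNIV_Suc: "card (lang UNIV (Suc n)) = card (lang UNIV n) + 2 * card (special UNIV n)"
proof -
  have "ext UNIV n A \<inter> ext UNIV n B \<inter> ext UNIV n C = ext UNIV n A \<inter> ext UNIV n C"
    using ext_A_C_imp_B by blast
  then show ?thesis
    using card_Un3[OF finite_ext finite_ext finite_ext, of UNIV n A UNIV n B UNIV n C]
      card_lang_Suc[of UNIV n] card_ext_swap[of UNIV n]
    by (simp add: Un_ext special_def)
qed

section \<open>Backward orbits of the discontinuity\<close>

text \<open>The equation \<open>final \<epsilon> w x = \<epsilon>\<close> says (wts w + 1) *
  \<epsilon> = x + ups w, and x lies in [0, 1). The extra 1 is there because the orbit ends at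
  \<epsilon>, the first multiple, and not at 0.\<close>

lemma hit_position:
  assumes "adm \<epsilon> l" "follows \<epsilon> l w x" "final \<epsilon> w x = \<epsilon>"
  shows "0 \<le> x" "x < l" "\<lfloor>real (Suc (wts w)) * \<epsilon>\<rfloor> = int (ups w)"
    "frac (real (Suc (wts w)) * \<epsilon>) = x"
proof -
  have "0 \<le> x \<and> x < l"
  proof (cases w)
    case Nil
    then show ?thesis using assms by (auto simp: adm_def)
  next
    case (Cons a u)
    then show ?thesis using assms by (cases a) (auto simp: adm_def)
  qed
  then show x: "0 \<le> x" "x < l" by auto
  have eq: "real (Suc (wts w)) * \<epsilon> = x + of_int (int (ups w))"
    using assms(3) by (simp add: final_def algebra_simps)
  have "x < 1" using x assms(1) by (auto simp: adm_def)
  then show "\<lfloor>real (Suc (wts w)) * \<epsilon>\<rfloor> = int (ups w)"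
    unfolding eq using x by (simp add: floor_eq_iff)
  then show "frac (real (Suc (wts w)) * \<epsilon>) = x"
    unfolding frac_def using eq by simp
qed

text \<open>This is the rotation point x + 1 - \<epsilon> in [l, 1) that the letter B jumps over;
  its index is one less than that of x.\<close>

lemma hit_mid_position:
  assumes "adm \<epsilon> l" "follows \<epsilon> l (B # u) x" "final \<epsilon> (B # u) x = \<epsilon>"
  shows "\<lfloor>real (Suc (Suc (wts u))) * \<epsilon>\<rfloor> = int (ups u)"
    "l \<le> frac (real (Suc (Suc (wts u))) * \<epsilon>)"
proof -
  have eq: "real (Suc (Suc (wts u))) * \<epsilon> = (x + 1 - \<epsilon>) + of_int (int (ups u))"
    using assms(3) by (simp add: final_def move_def algebra_simps)
  have *: "l \<le> x + 1 - \<epsilon>" "x + 1 - \<epsilon> < 1" "0 < l" using assms(1,2) by (auto simp: adm_def)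
  then show f: "\<lfloor>real (Suc (Suc (wts u))) * \<epsilon>\<rfloor> = int (ups u)"
    unfolding eq by (simp add: floor_eq_iff)
  show "l \<le> frac (real (Suc (Suc (wts u))) * \<epsilon>)"
    unfolding frac_def f using eq * by simp
qed

text \<open>These are the indices of the rotation orbit that the induced map skips.\<close>

definition over :: "real \<Rightarrow> real \<Rightarrow> nat \<Rightarrow> nat set" where
  "over \<epsilon> l m = {j \<in> {1..m}. l \<le> frac (real j * \<epsilon>)}"

lemma finite_over [simp]: "finite (over \<epsilon> l m)"
  by (simp add: over_def)

lemma over_0 [simp]: "over \<epsilon> l 0 = {}"
  by (simp add: over_def)

lemma over_Suc:
  "over \<epsilon> l (Suc m) = (if l \<le> frac (real (Suc m) * \<epsilon>) then insert (Suc m) (over \<epsilon> l m) else over \<epsilon> l m)"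
  by (auto simp: over_def le_Suc_eq simp del: of_nat_Suc)

lemma card_over_Suc:
  "card (over \<epsilon> l (Suc m)) = card (over \<epsilon> l m) + (if l \<le> frac (real (Suc m) * \<epsilon>) then 1 else 0)"
proof -
  have "Suc m \<notin> over \<epsilon> l m" by (simp add: over_def)
  then show ?thesis by (simp add: over_Suc)
qed

text \<open>Prepending a letter adds the index of the new starting point, which lies below l, and
  for B also the index jumped over, which does not.\<close>

lemma card_over_hit:
  assumes "adm \<epsilon> l" "follows \<epsilon> l w x" "final \<epsilon> w x = \<epsilon>"
  shows "card (over \<epsilon> l (Suc (wts w))) = count_list w B"
  using assms(2,3)
proof (induction w arbitrary: x)
  case Nil
  then have "\<not> l \<le> frac (real (Suc 0) * \<epsilon>)"
    using hit_position[OF assms(1), of "[]" x] by simp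
  then show ?case using card_over_Suc[of \<epsilon> l 0] by simp
next
  case (Cons a u)
  have IH: "card (over \<epsilon> l (Suc (wts u))) = count_list u B"
    using Cons.IH[of "move \<epsilon> a x"] Cons.prems by simp
  have last: "\<not> l \<le> frac (real (Suc (wts (a # u))) * \<epsilon>)"
    using hit_position[OF assms(1) Cons.prems] by simp
  show ?case
  proof (cases a)
    case B
    have "l \<le> frac (real (Suc (Suc (wts u))) * \<epsilon>)"
      using hit_mid_position[OF assms(1)] Cons.prems B by blast
    then show ?thesis
      using IH last card_over_Suc[of \<epsilon> l "Suc (wts u)"] card_over_Suc[of \<epsilon> l "Suc (Suc (wts u))"] B
      by (simp del: of_nat_Suc)
  qed (use IH last card_over_Suc[of \<epsilon> l "Suc (wts u)"] in \<open>simp_all del: of_nat_Suc\<close>)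
qed

text \<open>A word ending at the discontinuity records the Sturmian coding of the multiples of \<open>\<epsilon>\<close>.\<close>

lemma hit_floor_cong:
  assumes "adm \<epsilon> l" "follows \<epsilon> l w x" "final \<epsilon> w x = \<epsilon>"
    and "adm \<epsilon>' l'" "follows \<epsilon>' l' w x'" "final \<epsilon>' w x' = \<epsilon>'"
    and "1 \<le> j" "j \<le> Suc (wts w)"
  shows "\<lfloor>real j * \<epsilon>\<rfloor> = \<lfloor>real j * \<epsilon>'\<rfloor>"
  using assms(2,3,5,6,8)
proof (induction w arbitrary: x x')
  case Nil
  then have j: "j = Suc (wts [])" using assms(7) by simp
  show ?case unfolding j
    using hit_position(3)[OF assms(1), of "[]" x] hit_position(3)[OF assms(4), of "[]" x'] Nil by simp
next
  case (Cons a u)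
  consider "j \<le> Suc (wts u)" | "j = Suc (wts (a # u))" | "a = B" "j = Suc (Suc (wts u))"
    using Cons.prems(5) by (cases a) (auto simp: le_Suc_eq)
  then show ?case
  proof cases
    case 1
    then show ?thesis using Cons by auto
  next
    case 2
    then show ?thesis
      using hit_position(3)[OF assms(1) Cons.prems(1,2)] hit_position(3)[OF assms(4) Cons.prems(3,4)]
      by simp
  next
    case 3
    then show ?thesis
      using hit_mid_position(1)[OF assms(1)] hit_mid_position(1)[OF assms(4)] Cons.prems by metis
  qed
qed

text \<open>A first letter B in only one of the words would make some index skipped for that word
  and visited for the other. So the weights agree, the integer parts give equal \<open>up\<close>,
  and a letter is determined by \<open>wt\<close> and \<open>up\<close>.\<close>

lemma hit_determined:
  assumes "adm \<epsilon> l" "follows \<epsilon> l w x" "final \<epsilon> w x = \<epsilon>"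
    and "adm \<epsilon>' l'" "follows \<epsilon>' l' w' x'" "final \<epsilon>' w' x' = \<epsilon>'"
    and "wts w = wts w'"
    and "\<And>j. 1 \<le> j \<Longrightarrow> j \<le> Suc (wts w) \<Longrightarrow> \<lfloor>real j * \<epsilon>\<rfloor> = \<lfloor>real j * \<epsilon>'\<rfloor>"
    and "over \<epsilon> l (Suc (wts w)) = over \<epsilon>' l' (Suc (wts w))"
  shows "w = w'"
  using assms(2,3,5-9)
proof (induction w arbitrary: w' x x')
  case Nil
  then show ?case by (cases w'; cases "hd w'") auto
next
  case (Cons a u)
  obtain a' u' where w': "w' = a' # u'"
    using Cons.prems(5) by (cases w'; cases a) auto
  have u: "follows \<epsilon> l u (move \<epsilon> a x)" "final \<epsilon> u (move \<epsilon> a x) = \<epsilon>"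
    and u': "follows \<epsilon>' l' u' (move \<epsilon>' a' x')" "final \<epsilon>' u' (move \<epsilon>' a' x') = \<epsilon>'"
    using Cons.prems w' by auto
  have over_iff: "l \<le> frac (real j * \<epsilon>) \<longleftrightarrow> l' \<le> frac (real j * \<epsilon>')"
    if "1 \<le> j" "j \<le> Suc (wts (a # u))" for j
    using Cons.prems(7) that unfolding over_def by auto
  have low: "\<not> l \<le> frac (real (Suc (wts u)) * \<epsilon>)" "\<not> l' \<le> frac (real (Suc (wts u')) * \<epsilon>')"
    using hit_position[OF assms(1) u] hit_position[OF assms(4) u'] by auto
  have "wts u = wts u'"
  proof (rule ccontr)
    assume neq: "wts u \<noteq> wts u'"
    consider "a = B" "a' \<noteq> B" "wts u' = Suc (wts u)" | "a \<noteq> B" "a' = B" "wts u = Suc (wts u')"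
      using Cons.prems(5) w' neq by (cases a; cases a') auto
    then show False
    proof cases
      case 1
      then have "l \<le> frac (real (Suc (wts u')) * \<epsilon>)"
        using hit_mid_position(2)[OF assms(1), of u x] Cons.prems by metis
      then show False using over_iff[of "Suc (wts u')"] low 1 by (simp del: of_nat_Suc)
    next
      case 2
      then have "l' \<le> frac (real (Suc (wts u)) * \<epsilon>')"
        using hit_mid_position(2)[OF assms(4), of u' x'] Cons.prems w' by metis
      then show False using over_iff[of "Suc (wts u)"] low 2 by (simp del: of_nat_Suc)
    qed
  qed
  moreover have "u = u'"
  proof (rule Cons.IH[OF u u' \<open>wts u = wts u'\<close>])
    show "\<lfloor>real j * \<epsilon>\<rfloor> = \<lfloor>real j * \<epsilon>'\<rfloor>" if "1 \<le> j" "j \<le> Suc (wts u)" for j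
      using Cons.prems(6)[of j] that by simp
    show "over \<epsilon> l (Suc (wts u)) = over \<epsilon>' l' (Suc (wts u))"
      unfolding over_def using over_iff by auto
  qed
  moreover have "up a = up a'"
  proof -
    have "int (ups (a # u)) = int (ups (a' # u'))"
      using hit_position(3)[OF assms(1) Cons.prems(1,2)] hit_position(3)[OF assms(4) Cons.prems(3,4)]
        Cons.prems(5) Cons.prems(6)[of "Suc (wts (a # u))"] w' by (simp del: of_nat_Suc)
    then show ?thesis using \<open>u = u'\<close> by simp
  qed
  moreover have "wt a = wt a'" using Cons.prems(5) w' \<open>wts u = wts u'\<close> by simp
  ultimately show ?case unfolding w' by (cases a; cases a') auto
qed

text \<open>The comparison of \<open>frac (i * \<epsilon>)\<close> and \<open>frac (j * \<epsilon>)\<close> can be read off the integer parts,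
  since for \<open>i < j\<close> it amounts to comparing \<open>(j - i) * \<epsilon>\<close> with an integer. So the points above a
  threshold are known as soon as their number is.\<close>

lemma frac_less_cong:
  assumes "\<And>j. 1 \<le> j \<Longrightarrow> j \<le> m \<Longrightarrow> \<lfloor>real j * \<epsilon>\<rfloor> = \<lfloor>real j * \<epsilon>'\<rfloor>"
    and "1 \<le> i" "i < j" "j \<le> m"
  shows "frac (real j * \<epsilon>) < frac (real i * \<epsilon>) \<longleftrightarrow> frac (real j * \<epsilon>') < frac (real i * \<epsilon>')"
proof -
  have *: "frac (real j * e) < frac (real i * e) \<longleftrightarrow>
      \<lfloor>real (j - i) * e\<rfloor> < \<lfloor>real j * e\<rfloor> - \<lfloor>real i * e\<rfloor>" for e :: real
  proof -
    have d: "real (j - i) * e = real j * e - real i * e"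
      using \<open>i < j\<close> by (simp add: left_diff_distrib)
    show ?thesis unfolding d floor_less_iff frac_def by auto
  qed
  show ?thesis
    unfolding * using assms(1)[of i] assms(1)[of j] assms(1)[of "j - i"] assms(2-4) by simp
qed

lemma over_determined:
  assumes "\<And>j. 1 \<le> j \<Longrightarrow> j \<le> m \<Longrightarrow> \<lfloor>real j * \<epsilon>\<rfloor> = \<lfloor>real j * \<epsilon>'\<rfloor>"
    and "card (over \<epsilon> l m) = card (over \<epsilon>' l' m)"
  shows "over \<epsilon> l m = over \<epsilon>' l' m"
proof (rule ccontr)
  assume "over \<epsilon> l m \<noteq> over \<epsilon>' l' m"
  \<comment> \<open>Distinct finite sets of equal size do not contain each other; an element from
    each difference gives two multiples ordered oppositely for \<epsilon> and \<epsilon>'.\<close>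
  then obtain i j where i: "i \<in> over \<epsilon> l m" "i \<notin> over \<epsilon>' l' m"
    and j: "j \<in> over \<epsilon>' l' m" "j \<notin> over \<epsilon> l m"
    using assms(2) card_subset_eq[of "over \<epsilon> l m" "over \<epsilon>' l' m"]
      card_subset_eq[of "over \<epsilon>' l' m" "over \<epsilon> l m"] by auto
  then have *: "1 \<le> i" "i \<le> m" "1 \<le> j" "j \<le> m"
    "frac (real j * \<epsilon>) < frac (real i * \<epsilon>)" "frac (real i * \<epsilon>') < frac (real j * \<epsilon>')"
    by (auto simp: over_def)
  then consider "i < j" | "j < i" by (cases i j rule: linorder_cases) auto
  then show False
    using frac_less_cong[of m \<epsilon> \<epsilon>' i j] frac_less_cong[of m \<epsilon> \<epsilon>' j i] assms(1) * by cases auto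
qed

text \<open>Each term is monotone in the angle, so a difference in one term could not be compensated
  by another. Hence a single integer stands for the whole list of integer parts.\<close>

lemma floor_eq_of_sum_eq:
  fixes \<epsilon> \<epsilon>' :: real
  assumes "(\<Sum>j = 1..m. \<lfloor>real j * \<epsilon>\<rfloor>) = (\<Sum>j = 1..m. \<lfloor>real j * \<epsilon>'\<rfloor>)" and "1 \<le> i" "i \<le> m"
  shows "\<lfloor>real i * \<epsilon>\<rfloor> = \<lfloor>real i * \<epsilon>'\<rfloor>"
proof -
  have *: "\<lfloor>real i * e\<rfloor> = \<lfloor>real i * e'\<rfloor>"
    if "e \<le> e'" "(\<Sum>j = 1..m. \<lfloor>real j * e\<rfloor>) = (\<Sum>j = 1..m. \<lfloor>real j * e'\<rfloor>)" for e e' :: real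
    using assms(2,3) that
    by (intro sum_mono_inv[OF that(2)]) (auto intro!: floor_mono mult_left_mono)
  show ?thesis
  proof (cases "\<epsilon> \<le> \<epsilon>'")
    case True
    then show ?thesis using assms(1) by (rule *)
  next
    case False
    then have "\<epsilon>' \<le> \<epsilon>" by simp
    from *[OF this assms(1)[symmetric]] show ?thesis by (rule sym)
  qed
qed

lemma hit_word_eqI:
  assumes "adm \<epsilon> l" "follows \<epsilon> l w x" "final \<epsilon> w x = \<epsilon>"
    and "adm \<epsilon>' l'" "follows \<epsilon>' l' w' x'" "final \<epsilon>' w' x' = \<epsilon>'"
    and "length w = length w'" "count_list w B = count_list w' B"
    and "(\<Sum>j = 1..Suc (wts w). \<lfloor>real j * \<epsilon>\<rfloor>) = (\<Sum>j = 1..Suc (wts w'). \<lfloor>real j * \<epsilon>'\<rfloor>)"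
  shows "w = w'"
proof -
  have wts: "wts w = wts w'" using assms(7,8) by (simp add: wts_eq_length)
  have fl: "\<lfloor>real j * \<epsilon>\<rfloor> = \<lfloor>real j * \<epsilon>'\<rfloor>" if "1 \<le> j" "j \<le> Suc (wts w)" for j
    using floor_eq_of_sum_eq[OF assms(9)[folded wts]] that by simp
  have "over \<epsilon> l (Suc (wts w)) = over \<epsilon>' l' (Suc (wts w))"
    using over_determined[of "Suc (wts w)" \<epsilon> \<epsilon>' l l'] fl wts
      card_over_hit[OF assms(1-3)] card_over_hit[OF assms(4-6)] assms(8) by simp
  then show ?thesis using hit_determined[OF assms(1-6) wts] fl by blast
qed

section \<open>The upper bound\<close>

lemma floor_step:
  fixes \<epsilon> y :: real
  assumes "0 < \<epsilon>" "\<epsilon> < 1"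
  shows "\<lfloor>y + \<epsilon>\<rfloor> = \<lfloor>y\<rfloor> + (if 1 - \<epsilon> \<le> frac y then 1 else 0)"
    "\<lfloor>y\<rfloor> = \<lfloor>y - \<epsilon>\<rfloor> + (if \<epsilon> \<le> frac y then 0 else 1)"
proof -
  have "\<lfloor>y + \<epsilon>\<rfloor> = (if 1 - \<epsilon> \<le> frac y then \<lfloor>y\<rfloor> + 1 else \<lfloor>y\<rfloor>)"
    using assms frac_ge_0[of y] frac_lt_1[of y] by (auto simp: frac_def floor_eq_iff) linarith
  then show "\<lfloor>y + \<epsilon>\<rfloor> = \<lfloor>y\<rfloor> + (if 1 - \<epsilon> \<le> frac y then 1 else 0)" by simp
  have "\<lfloor>y - \<epsilon>\<rfloor> = (if \<epsilon> \<le> frac y then \<lfloor>y\<rfloor> else \<lfloor>y\<rfloor> - 1)"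
    using assms frac_ge_0[of y] frac_lt_1[of y] by (auto simp: frac_def floor_eq_iff) linarith
  then show "\<lfloor>y\<rfloor> = \<lfloor>y - \<epsilon>\<rfloor> + (if \<epsilon> \<le> frac y then 0 else 1)" by simp
qed

text \<open>The fractional part of j * \<epsilon> is at least 1 - \<epsilon> exactly when the step
  to j + 1 passes an integer, so this counts the integers passed up to (m + 1) * \<epsilon>.\<close>

lemma card_over_1_minus:
  assumes "0 < \<epsilon>" "\<epsilon> < 1"
  shows "int (card (over \<epsilon> (1 - \<epsilon>) m)) = \<lfloor>real (Suc m) * \<epsilon>\<rfloor>"
proof (induction m)
  case 0
  then show ?case using assms by (simp add: floor_eq_iff)
next
  case (Suc m)
  have "real (Suc (Suc m)) * \<epsilon> = real (Suc m) * \<epsilon> + \<epsilon>" by (simp add: algebra_simps)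
  then show ?case
    using Suc floor_step(1)[OF assms, of "real (Suc m) * \<epsilon>"] by (simp add: card_over_Suc del: of_nat_Suc)
qed

text \<open>The indices left out are those whose preceding step passed an integer, and there are as
  many as the integer part of m * \<epsilon>.\<close>

lemma card_over_self:
  assumes "0 < \<epsilon>" "\<epsilon> < 1"
  shows "int (card (over \<epsilon> \<epsilon> m)) = int m - \<lfloor>real m * \<epsilon>\<rfloor>"
proof (induction m)
  case (Suc m)
  have "real m * \<epsilon> = real (Suc m) * \<epsilon> - \<epsilon>" by (simp add: algebra_simps)
  then show ?case
    using Suc floor_step(2)[OF assms, of "real (Suc m) * \<epsilon>"] by (simp add: card_over_Suc del: of_nat_Suc)
qed simp

lemma card_over_bounds:
  assumes "adm \<epsilon> l"
  shows "real (card (over \<epsilon> l m)) \<le> real (Suc m) * \<epsilon>"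
    "m \<ge> 1 \<Longrightarrow> real (card (over \<epsilon> l m)) \<le> real m * (1 - \<epsilon>)"
proof -
  have e: "0 < \<epsilon>" "\<epsilon> < 1" using assms by (auto simp: adm_def)
  have "card (over \<epsilon> l m) \<le> card (over \<epsilon> (1 - \<epsilon>) m)"
    using assms by (intro card_mono) (auto simp: over_def adm_def)
  then show "real (card (over \<epsilon> l m)) \<le> real (Suc m) * \<epsilon>"
    using card_over_1_minus[OF e, of m] by linarith
  assume m: "m \<ge> 1"
  have f: "frac \<epsilon> = \<epsilon>" using e by (simp add: frac_eq)
  \<comment> \<open>The index 1 sits exactly at \<epsilon>, hence below l. The strictness makes up
    for the rounding in the integer part of m * \<epsilon>.\<close>
  have "over \<epsilon> l m \<subset> over \<epsilon> \<epsilon> m"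
  proof
    show "over \<epsilon> l m \<subseteq> over \<epsilon> \<epsilon> m" using assms by (auto simp: over_def adm_def)
    have "1 \<in> over \<epsilon> \<epsilon> m" "1 \<notin> over \<epsilon> l m" using m f assms by (auto simp: over_def adm_def)
    then show "over \<epsilon> l m \<noteq> over \<epsilon> \<epsilon> m" by blast
  qed
  then have "card (over \<epsilon> l m) < card (over \<epsilon> \<epsilon> m)" by (intro psubset_card_mono) auto
  then have "int (card (over \<epsilon> l m)) \<le> int m - \<lfloor>real m * \<epsilon>\<rfloor> - 1"
    using card_over_self[OF e, of m] by linarith
  then show "real (card (over \<epsilon> l m)) \<le> real m * (1 - \<epsilon>)"
    by (simp add: algebra_simps) linarith
qed

lemma sum_floor_bounds:
  fixes \<epsilon> :: real
  shows "\<epsilon> * (real m * real (Suc m) / 2) - real m \<le> real_of_int (\<Sum>j = 1..m. \<lfloor>real j * \<epsilon>\<rfloor>)"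
    "real_of_int (\<Sum>j = 1..m. \<lfloor>real j * \<epsilon>\<rfloor>) \<le> \<epsilon> * (real m * real (Suc m) / 2)"
proof -
  have s: "(\<Sum>j = 1..m. real j * \<epsilon>) = \<epsilon> * (real m * real (Suc m) / 2)"
    by (induction m) (auto simp: field_simps)
  have "(\<Sum>j = 1..m. real j * \<epsilon> - 1) \<le> (\<Sum>j = 1..m. real_of_int \<lfloor>real j * \<epsilon>\<rfloor>)"
    by (intro sum_mono) linarith
  then show "\<epsilon> * (real m * real (Suc m) / 2) - real m \<le> real_of_int (\<Sum>j = 1..m. \<lfloor>real j * \<epsilon>\<rfloor>)"
    by (simp add: sum_subtractf s del: One_nat_def of_nat_Suc)
  have "(\<Sum>j = 1..m. real_of_int \<lfloor>real j * \<epsilon>\<rfloor>) \<le> (\<Sum>j = 1..m. real j * \<epsilon>)"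
    by (intro sum_mono) linarith
  then show "real_of_int (\<Sum>j = 1..m. \<lfloor>real j * \<epsilon>\<rfloor>) \<le> \<epsilon> * (real m * real (Suc m) / 2)"
    by (simp add: s del: One_nat_def of_nat_Suc)
qed

lemma int_between_eq: "{s::int. u \<le> of_int s \<and> of_int s \<le> v} = {\<lceil>u\<rceil>..\<lfloor>v\<rfloor>}" for u v :: real
  by (auto simp: ceiling_le_iff le_floor_iff)

lemma finite_int_between: "finite {s::int. u \<le> of_int s \<and> of_int s \<le> v}" for u v :: real
  unfolding int_between_eq by simp

lemma card_int_between_le:
  fixes u v :: real
  assumes "u \<le> v"
  shows "real (card {s::int. u \<le> of_int s \<and> of_int s \<le> v}) \<le> v - u + 1"
  unfolding int_between_eq using assms by (simp, linarith)

definition hits :: "nat \<Rightarrow> nat \<Rightarrow> letter list set" where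
  "hits n b = {w. length w = n \<and> count_list w B = b \<and>
     (\<exists>\<epsilon> l x. adm \<epsilon> l \<and> follows \<epsilon> l w x \<and> final \<epsilon> w x = \<epsilon>)}"

text \<open>The sum of the integer parts is an injective code for these words, so it suffices to
  count the integers in the interval [u, v] that contains it. The hypothesis on b is 2 * b \<le> m +
  1, which ensures u \<le> v.\<close>

lemma card_hits_le:
  fixes n b :: nat
  defines "m \<equiv> n + b + 1"
  assumes "b \<le> n + 2"
  shows "real (card (hits n b)) \<le> real m * (real m + 1 - 2 * real b) / 2 + real m + 1"
proof -
  \<comment> \<open>\<open>u\<close> and \<open>v\<close> are the two bounds of
    \<open>sum_floor_bounds\<close>, the lower one at \<epsilon> = b / (m + 1) and the upper one at
    \<epsilon> = 1 - b / m.\<close>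
  define u where "u = real b * real m / 2 - real m"
  define v where "v = (1 - real b / real m) * (real m * real (Suc m) / 2)"
  define Sig where "Sig w s \<longleftrightarrow> (\<exists>\<epsilon> l x. adm \<epsilon> l \<and> follows \<epsilon> l w x \<and> final \<epsilon> w x = \<epsilon> \<and>
     s = (\<Sum>j = 1..Suc (wts w). \<lfloor>real j * \<epsilon>\<rfloor>))" for w s
  \<comment> \<open>A word may be realised by many angles; any choice will do, since
    \<open>hit_word_eqI\<close> applies to arbitrary realisations.\<close>
  define f where "f w = (SOME s. Sig w s)" for w
  have m: "m > 0" by (simp add: m_def)
  have Sig: "Sig w (f w)" if "w \<in> hits n b" for w
    unfolding f_def by (rule someI_ex) (use that in \<open>auto simp: hits_def Sig_def\<close>)
  have wts: "Suc (wts w) = m" if "w \<in> hits n b" for w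
    using that by (simp add: hits_def wts_eq_length m_def)
  have "inj_on f (hits n b)"
  proof (rule inj_onI)
    fix w w' assume *: "w \<in> hits n b" "w' \<in> hits n b" "f w = f w'"
    have "Sig w' (f w)" using Sig[OF *(2)] *(3) by simp
    with Sig[OF *(1)] obtain \<epsilon> l x \<epsilon>' l' x' where
      "adm \<epsilon> l" "follows \<epsilon> l w x" "final \<epsilon> w x = \<epsilon>" "adm \<epsilon>' l'" "follows \<epsilon>' l' w' x'" "final \<epsilon>' w' x' = \<epsilon>'"
      "(\<Sum>j = 1..Suc (wts w). \<lfloor>real j * \<epsilon>\<rfloor>) = (\<Sum>j = 1..Suc (wts w'). \<lfloor>real j * \<epsilon>'\<rfloor>)"
      unfolding Sig_def by metis
    with hit_word_eqI[OF this(1-6)] *(1,2) show "w = w'" by (simp add: hits_def)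
  qed
  moreover have "f ` hits n b \<subseteq> {s. u \<le> of_int s \<and> of_int s \<le> v}"
  proof
    fix s assume "s \<in> f ` hits n b"
    then obtain w where w: "w \<in> hits n b" "s = f w" by blast
    obtain \<epsilon> l x where *: "adm \<epsilon> l" "follows \<epsilon> l w x" "final \<epsilon> w x = \<epsilon>" "s = (\<Sum>j = 1..m. \<lfloor>real j * \<epsilon>\<rfloor>)"
      using Sig[OF w(1)] w(2) wts[OF w(1)] unfolding Sig_def by auto
    have b: "card (over \<epsilon> l m) = b"
      using card_over_hit[OF *(1-3)] w(1) wts[OF w(1)] by (simp add: hits_def)
    have lo: "real b \<le> real (Suc m) * \<epsilon>" and hi: "real b \<le> real m * (1 - \<epsilon>)"
      using card_over_bounds[OF *(1), of m] b m by auto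
    have "real b * (real m / 2) \<le> real (Suc m) * \<epsilon> * (real m / 2)"
      using lo by (rule mult_right_mono) simp
    then have "u \<le> \<epsilon> * (real m * real (Suc m) / 2) - real m"
      by (simp add: u_def algebra_simps)
    moreover have "\<epsilon> \<le> 1 - real b / real m" using hi m by (simp add: field_simps)
    then have "\<epsilon> * (real m * real (Suc m) / 2) \<le> v"
      unfolding v_def by (rule mult_right_mono) simp
    ultimately show "s \<in> {s. u \<le> of_int s \<and> of_int s \<le> v}"
      using sum_floor_bounds[of \<epsilon> m] *(4) by auto
  qed
  moreover have v: "v = (real m - real b) * real (Suc m) / 2"
    using m by (simp add: v_def field_simps)
  have "u = real b * real m / 2 - real m" by (simp add: u_def)
  with v have vu: "v - u = real m * (real m + 1 - 2 * real b) / 2 - real b / 2 + real m"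
    by (simp add: field_simps)
  have "u \<le> v"
  proof -
    have b: "2 * real b \<le> real m + 1" "real b \<le> real m" using assms by auto
    have "0 \<le> real m * (real m + 1 - 2 * real b)" using b by (intro mult_nonneg_nonneg) auto
    then show ?thesis using b(2) vu by linarith
  qed
  ultimately have "real (card (hits n b)) \<le> v - u + 1"
    using card_inj_on_le[OF _ _ finite_int_between[of u v], of f "hits n b"]
      card_int_between_le[of u v] by force
  also have "v - u + 1 \<le> real m * (real m + 1 - 2 * real b) / 2 + real m + 1"
    using vu by linarith
  finally show ?thesis .
qed

lemma card_special_le:
  "real (card (special UNIV n)) \<le> (real n + 2) * (real n + 3) * (2 * real n + 11) / 6"
proof -
  have sub: "special UNIV n \<subseteq> (\<Union>b\<in>{..n + 2}. hits n b)"
  proof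
    fix w assume "w \<in> special UNIV n"
    then obtain \<epsilon> l x where *: "length w = n" "adm \<epsilon> l" "follows \<epsilon> l w x" "final \<epsilon> w x = \<epsilon>"
      using special_imp_hits by blast
    have "count_list w B \<le> length w" by (rule count_le_length)
    then show "w \<in> (\<Union>b\<in>{..n + 2}. hits n b)"
      unfolding hits_def using * by auto
  qed
  have fin: "finite (\<Union>b\<in>{..n + 2}. hits n b)"
    by (rule finite_subset[OF _ finite_words[of n]]) (auto simp: hits_def)
  have "card (special UNIV n) \<le> (\<Sum>b\<le>n + 2. card (hits n b))"
    using card_mono[OF fin sub] card_UN_le[of "{..n + 2}" "hits n"] by simp
  then have "real (card (special UNIV n)) \<le> (\<Sum>b\<le>n + 2. real (card (hits n b)))"
    by (metis of_nat_le_iff of_nat_sum)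
  \<comment> \<open>This is the bound of \<open>card_hits_le\<close> at m = n + b + 1, expressed
    through n + 2. The sum runs as far as that bound applies, although b \<le> n holds for words of
    length n.\<close>
  also have "\<dots> \<le> (\<Sum>b\<le>n + 2. ((real n + 2)^2 + (real n + 2)) / 2 + 3 / 2 * real b - (real b)^2 / 2)"
    by (intro sum_mono order_trans[OF card_hits_le])
      (auto simp: field_simps power2_eq_square)
  also have "\<dots> = (real n + 2) * (real n + 3) * (2 * real n + 11) / 6"
  proof -
    have sum_eq: "(\<Sum>b\<le>k. c + 3 / 2 * real b - (real b)^2 / 2) =
        (real k + 1) * c + 3 * real k * (real k + 1) / 4 - real k * (real k + 1) * (2 * real k + 1) / 12"
      for c :: real and k
      by (induction k) (auto simp: field_simps power2_eq_square)
    show ?thesis unfolding sum_eq by (simp add: field_simps power2_eq_square)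
  qed
  finally show ?thesis .
qed

lemma card_lang_UNIV_le: "real (card (lang UNIV N)) \<le> real N ^ 4 / 6 + 22 * real N ^ 3 + 1"
proof (induction N)
  case 0
  have "lang UNIV 0 \<subseteq> {[]}" by (auto simp: lang_def)
  then have "card (lang UNIV 0) \<le> card {[] :: letter list}" by (intro card_mono) auto
  then show ?case by simp
next
  case (Suc n)
  have "real (card (lang UNIV (Suc n))) \<le>
      real n ^ 4 / 6 + 22 * real n ^ 3 + 1 + (real n + 2) * (real n + 3) * (2 * real n + 11) / 3"
    using Suc card_special_le[of n] by (simp add: card_lang_UNIV_Suc)
  \<comment> \<open>The factor 22 is the growth term (n + 2) * (n + 3) * (2 * n + 11) / 3 at n =
    0.\<close>
  also have "\<dots> \<le> real (Suc n) ^ 4 / 6 + 22 * real (Suc n) ^ 3 + 1"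
    by (simp add: field_simps power4_eq_xxxx power3_eq_cube)
  finally show ?case .
qed

section \<open>Realising prescribed special factors\<close>

lemma frac_backward:
  fixes \<epsilon> y :: real
  assumes "0 < \<epsilon>" "\<epsilon> < 1"
  shows "frac (y - \<epsilon>) = (if \<epsilon> \<le> frac y then frac y - \<epsilon> else frac y + 1 - \<epsilon>)"
  using assms floor_step(2)[OF assms, of y] by (auto simp: frac_def)

lemma irrational_mult_not_int:
  assumes "\<epsilon> \<notin> \<rat>" "j \<noteq> 0" "r \<in> \<rat>"
  shows "real j * \<epsilon> \<noteq> r"
proof
  assume "real j * \<epsilon> = r"
  then have "\<epsilon> = r / real j" using assms(2) by (simp add: field_simps)
  then show False using assms by (auto intro: Rats_divide)
qed

lemma frac_mult_inj:
  assumes "\<epsilon> \<notin> \<rat>" "frac (real i * \<epsilon>) = frac (real j * \<epsilon>)"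
  shows "i = j"
proof -
  have *: False if "i < j" "frac (real i * \<epsilon>) = frac (real j * \<epsilon>)" for i j
  proof -
    have "real (j - i) * \<epsilon> = of_int (\<lfloor>real j * \<epsilon>\<rfloor> - \<lfloor>real i * \<epsilon>\<rfloor>)"
      using that by (simp add: frac_def left_diff_distrib)
    then show False using irrational_mult_not_int[OF assms(1), of "j - i"] that(1)
      by (metis Rats_of_int zero_less_diff less_irrefl)
  qed
  show ?thesis using *[of i j] *[of j i] assms(2) by (cases i j rule: linorder_cases) auto
qed

text \<open>The multiples of \<epsilon> are followed down to the first one, by one index for A or C
  and by two for B. Irrationality and the avoidance of l keep every point off the ends of the
  pieces, so the word is followed strictly.\<close>

lemma ex_word_to_discontinuity:
  assumes "adm \<epsilon> l" "\<epsilon> \<notin> \<rat>" "\<And>i. 1 \<le> i \<Longrightarrow> i \<le> j \<Longrightarrow> frac (real i * \<epsilon>) \<noteq> l"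
    and "1 \<le> j" "frac (real j * \<epsilon>) < l"
  shows "\<exists>w. sfollows \<epsilon> l w (frac (real j * \<epsilon>)) \<and> final \<epsilon> w (frac (real j * \<epsilon>)) = \<epsilon> \<and> Suc (wts w) = j"
  using assms(3-5)
proof (induction j rule: less_induct)
  case (less j)
  have e: "0 < \<epsilon>" "\<epsilon> < 1" "\<epsilon> < l" "1 - \<epsilon> < l" "l < 1" using assms(1) by (auto simp: adm_def)
  then have fe: "frac \<epsilon> = \<epsilon>" by (simp add: frac_eq)
  define x where "x = frac (real j * \<epsilon>)"
  have x: "0 \<le> x" "x < l" using less.prems by (auto simp: x_def)
  have "x \<noteq> 0"
    using irrational_mult_not_int[OF assms(2), of j "of_int \<lfloor>real j * \<epsilon>\<rfloor>"] less.prems(2)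
    by (auto simp: x_def frac_def)
  then have x0: "0 < x" using x by simp
  show ?case
  proof (cases "j = 1")
    case True
    then show ?thesis using fe by (intro exI[of _ "[]"]) simp
  next
    case False
    then have j: "j \<ge> 2" using less.prems by simp
    have "x \<noteq> \<epsilon>" using frac_mult_inj[OF assms(2), of j 1] False fe by (auto simp: x_def)
    have b1: "frac (real (j - 1) * \<epsilon>) = (if \<epsilon> \<le> x then x - \<epsilon> else x + 1 - \<epsilon>)"
      using frac_backward[OF e(1,2), of "real j * \<epsilon>"] j by (simp add: x_def of_nat_diff left_diff_distrib)
    show ?thesis
    proof (cases "frac (real (j - 1) * \<epsilon>) < l")
      case True
      obtain w where w: "sfollows \<epsilon> l w (frac (real (j - 1) * \<epsilon>))"
        "final \<epsilon> w (frac (real (j - 1) * \<epsilon>)) = \<epsilon>" "Suc (wts w) = j - 1"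
        using less.IH[OF _ less.prems(1) _ True] j by force
      define a where "a = (if \<epsilon> \<le> x then C else A)"
      have "move \<epsilon> a x = frac (real (j - 1) * \<epsilon>)" unfolding b1 by (simp add: a_def move_def)
      moreover have "x \<in> open_piece \<epsilon> l a"
        using True x x0 \<open>x \<noteq> \<epsilon>\<close> unfolding b1 a_def by (auto split: if_splits)
      moreover have "wt a = 1" by (simp add: a_def)
      ultimately show ?thesis
        using w by (intro exI[of _ "a # w"]) (auto simp: x_def[symmetric])
    next
      case high: False
      then have xl: "x < \<epsilon>" and b1': "frac (real (j - 1) * \<epsilon>) = x + 1 - \<epsilon>"
        using b1 x e by (auto split: if_splits)
      have gt: "l < x + 1 - \<epsilon>" using high less.prems(1)[of "j - 1"] j b1' by force
      \<comment> \<open>The first multiple is \<epsilon> < l, so a jump never passes over the index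
        1.\<close>
      have "j \<noteq> 2" using b1' fe gt e by auto
      then have j3: "j \<ge> 3" using j by simp
      have b2: "frac (real (j - 2) * \<epsilon>) = x + 1 - 2 * \<epsilon>"
      proof -
        have "real (j - 2) * \<epsilon> = real (j - 1) * \<epsilon> - \<epsilon>" using j3 by (simp add: of_nat_diff algebra_simps)
        then show ?thesis using frac_backward[OF e(1,2), of "real (j - 1) * \<epsilon>"] b1' gt e by simp
      qed
      have low: "frac (real (j - 2) * \<epsilon>) < l" unfolding b2 using xl e by simp
      obtain w where w: "sfollows \<epsilon> l w (frac (real (j - 2) * \<epsilon>))"
        "final \<epsilon> w (frac (real (j - 2) * \<epsilon>)) = \<epsilon>" "Suc (wts w) = j - 2"
        using less.IH[OF _ less.prems(1) _ low] j3 by force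
      have "move \<epsilon> B x = frac (real (j - 2) * \<epsilon>)" unfolding b2 by (simp add: move_def)
      moreover have "x \<in> open_piece \<epsilon> l B" using gt xl by auto
      ultimately show ?thesis
        using w j3 by (intro exI[of _ "B # w"]) (auto simp: x_def[symmetric])
    qed
  qed
qed

text \<open>At x itself the orbit ends at \<epsilon>, the left end of the piece of C. Shifting x to
  the left by less than 1 - l, the length of the piece of B, makes it end in that piece.\<close>

lemma special_of_sfollows:
  assumes "\<epsilon> \<in> E" "adm \<epsilon> l" "0 < x" "x < l" "sfollows \<epsilon> l w x" "final \<epsilon> w x = \<epsilon>" "length w = n"
  shows "w \<in> special E n"
proof -
  obtain d where d: "d > 0" "\<And>t. \<bar>t\<bar> < d \<Longrightarrow> sfollows \<epsilon> l w (x + t)"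
    using sfollows_near[OF assms(5)] by blast
  define t where "t = Min {d, x, 1 - l} / 2"
  have "0 < Min {d, x, 1 - l}" using d assms by (simp add: adm_def)
  then have t: "0 < t" "t < d" "t < x" "t < 1 - l" by (auto simp: t_def min_def)
  have "follows \<epsilon> l w (x - t)" using d(2)[of "- t"] t by (simp add: sfollows_imp_follows)
  moreover have "final \<epsilon> w (x - t) \<in> piece \<epsilon> l B"
    using assms(6) t by (simp add: final_def)
  ultimately have "w \<in> ext E n B"
    unfolding ext_iff using assms t by (intro conjI exI[of _ \<epsilon>] exI[of _ l] exI[of _ "x - t"]) auto
  moreover have "w \<in> ext E n C"
    unfolding ext_iff using assms sfollows_imp_follows[OF assms(5)]
    by (intro conjI exI[of _ \<epsilon>] exI[of _ l] exI[of _ x]) (auto simp: adm_def)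
  ultimately show ?thesis by (simp add: special_def)
qed

text \<open>As the threshold descends from u, the count grows one at a time because f is injective.
  Strictness of the hypothesis on b leaves a further value at or above c, so that l can stay
  strictly above c.\<close>

lemma ex_threshold:
  fixes f :: "nat \<Rightarrow> real"
  assumes "finite J" "inj_on f J" "\<And>j. j \<in> J \<Longrightarrow> f j < u" "c < u" "b < card {j \<in> J. c \<le> f j}"
  shows "\<exists>l. c < l \<and> l < u \<and> (\<forall>j\<in>J. f j \<noteq> l) \<and> card {j \<in> J. l \<le> f j} = b"
  using assms(5)
proof (induction b)
  case 0
  define m where "m = Max (insert c (f ` J))"
  have m: "c \<le> m" "\<And>j. j \<in> J \<Longrightarrow> f j \<le> m" using assms(1) by (auto simp: m_def)
  have "m \<in> insert c (f ` J)" unfolding m_def using assms(1) by (intro Max_in) auto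
  then have "m < u" using assms by auto
  then obtain l where l: "m < l" "l < u" using dense by blast
  have "{j \<in> J. l \<le> f j} = {}" using l m by force
  then have "card {j \<in> J. l \<le> f j} = 0" by (simp only: card.empty)
  moreover have "\<forall>j\<in>J. f j \<noteq> l" using l(1) m(2) by force
  ultimately show ?case using l m(1) by (intro exI[of _ l]) simp
next
  case (Suc b)
  then obtain l where l: "c < l" "l < u" "\<forall>j\<in>J. f j \<noteq> l" "card {j \<in> J. l \<le> f j} = b" by auto
  define S where "S = {j \<in> J. c \<le> f j \<and> f j < l}"
  have fin: "finite S" using assms(1) by (simp add: S_def)
  have "{j \<in> J. c \<le> f j} = S \<union> {j \<in> J. l \<le> f j}" using l by (auto simp: S_def)
  then have "card {j \<in> J. c \<le> f j} \<le> card S + b" using card_Un_le[of S "{j \<in> J. l \<le> f j}"] l(4) by simp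
  then have c2: "card S \<ge> 2" using Suc.prems by simp
  then have "S \<noteq> {}" by auto
  \<comment> \<open>The next threshold is put between \<open>y\<close>, the largest value below the
    old one, and \<open>z\<close>, the second largest or c. As \<open>S\<close> has two elements
    with different values, \<open>y\<close> exceeds c.\<close>
  define y where "y = Max (f ` S)"
  have "y \<in> f ` S" unfolding y_def using fin \<open>S \<noteq> {}\<close> by (intro Max_in) auto
  then obtain k where k: "k \<in> S" "f k = y" by auto
  have y: "\<And>j. j \<in> S \<Longrightarrow> f j \<le> y" using fin by (auto simp: y_def)
  have inj: "\<And>i j. i \<in> S \<Longrightarrow> j \<in> S \<Longrightarrow> f i = f j \<Longrightarrow> i = j" using assms(2) by (auto simp: S_def inj_on_def)
  define z where "z = Max (insert c (f ` (S - {k})))"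
  have z: "c \<le> z" "\<And>j. j \<in> S \<Longrightarrow> j \<noteq> k \<Longrightarrow> f j \<le> z" using fin by (auto simp: z_def)
  have "card (S - {k}) > 0" using c2 k by (simp add: card_Diff_singleton)
  then obtain i where i: "i \<in> S" "i \<noteq> k" by (metis Diff_iff card_gt_0_iff ex_in_conv singletonI)
  have "z \<in> insert c (f ` (S - {k}))" unfolding z_def using fin by (intro Max_in) auto
  moreover have "c < y" using i y[OF i(1)] inj[OF i(1) k(1)] k(2) by (force simp: S_def)
  moreover have "f j < y" if "j \<in> S - {k}" for j
    using y[of j] inj[OF _ k(1), of j] k(2) that by force
  ultimately have "z < y" by auto
  then obtain l' where l': "z < l'" "l' < y" using dense by blast
  have yl: "y < l" "k \<in> J" using k by (auto simp: S_def)
  have low: "f j < l'" if "j \<in> J" "f j < l" "j \<noteq> k" for j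
  proof (cases "c \<le> f j")
    case True
    then show ?thesis using z(2)[of j] that l' by (auto simp: S_def)
  qed (use l' z(1) in auto)
  have "{j \<in> J. l' \<le> f j} = insert k {j \<in> J. l \<le> f j}"
    using low l' yl k(2) by (force simp: not_less)
  moreover have "k \<notin> {j \<in> J. l \<le> f j}" using yl k(2) by auto
  ultimately have "card {j \<in> J. l' \<le> f j} = Suc b" using l(4) assms(1) by simp
  moreover have "f j \<noteq> l'" if "j \<in> J" for j
    using low[OF that] l(3) that l' yl k(2) by (metis less_irrefl linorder_less_linear order_less_trans)
  ultimately show ?case using l' z(1) yl l(2) by (intro exI[of _ l']) auto
qed


text \<open>The integer part is continuous from the right only; this is why rational angles are
  approached from the right.\<close>

lemma eventually_floor_at_right:
  "eventually (\<lambda>e. \<lfloor>real j * e\<rfloor> = \<lfloor>real j * r\<rfloor>) (at_right r)" for r :: real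
proof -
  have "((\<lambda>e. real j * e) \<longlongrightarrow> real j * r) (at_right r)" by (intro tendsto_intros)
  then have "eventually (\<lambda>e. real j * e < of_int (\<lfloor>real j * r\<rfloor> + 1)) (at_right r)"
    by (rule order_tendstoD) linarith
  moreover have "eventually (\<lambda>e. r < e) (at_right r)" by (rule eventually_at_right_less)
  ultimately show ?thesis
  proof eventually_elim
    case (elim e)
    have "real j * r \<le> real j * e" using elim by (intro mult_left_mono) auto
    then have "of_int \<lfloor>real j * r\<rfloor> \<le> real j * e" by linarith
    then show ?case using elim(1) by (simp add: floor_eq_iff)
  qed
qed

lemma ex_irrational_between:
  fixes a b :: real
  assumes "a < b"
  shows "\<exists>e. a < e \<and> e < b \<and> e \<notin> \<rat>"
proof (rule ccontr)
  assume "\<not> ?thesis"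
  then have "{a<..<b} \<subseteq> \<rat>" by auto
  then have "countable {a<..<b}" using countable_rat countable_subset by blast
  then show False using uncountable_open_interval[of a b] assms by blast
qed

lemma ex_irrational_right:
  fixes r :: real
  assumes "frac (real m * r) < max r (1 - r)" "0 < r" "r < 1" "r \<noteq> 1 / 2"
  shows "\<exists>e. e \<notin> \<rat> \<and> r < e \<and> e < 1 \<and> (r < 1 / 2 \<longrightarrow> e < 1 / 2) \<and> frac (real m * e) < max e (1 - e) \<and>
    (\<forall>j \<le> m. \<lfloor>real j * e\<rfloor> = \<lfloor>real j * r\<rfloor>)"
proof -
  have "eventually (\<lambda>e. \<forall>j\<in>{..m}. \<lfloor>real j * e\<rfloor> = \<lfloor>real j * r\<rfloor>) (at_right r)"
    by (intro eventually_ball_finite) (auto intro: eventually_floor_at_right)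
  moreover have "eventually (\<lambda>e. real m * e - of_int \<lfloor>real m * r\<rfloor> - max e (1 - e) < 0) (at_right r)"
    by (rule order_tendstoD(2)[where y = "real m * r - of_int \<lfloor>real m * r\<rfloor> - max r (1 - r)"])
      (use assms(1) in \<open>auto intro!: tendsto_intros simp: frac_def\<close>)
  moreover have "eventually (\<lambda>e. e < (if r < 1 / 2 then 1 / 2 else 1)) (at_right r)"
    by (rule order_tendstoD(2)[OF tendsto_ident_at]) (use assms in auto)
  ultimately have "eventually (\<lambda>e. e < 1 \<and> (r < 1 / 2 \<longrightarrow> e < 1 / 2) \<and> frac (real m * e) < max e (1 - e) \<and>
    (\<forall>j \<le> m. \<lfloor>real j * e\<rfloor> = \<lfloor>real j * r\<rfloor>)) (at_right r)"
    by eventually_elim (auto simp: frac_def split: if_splits)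
  then obtain b where b: "b > r" "\<And>e. r < e \<Longrightarrow> e < b \<Longrightarrow> e < 1 \<and> (r < 1 / 2 \<longrightarrow> e < 1 / 2) \<and>
    frac (real m * e) < max e (1 - e) \<and> (\<forall>j \<le> m. \<lfloor>real j * e\<rfloor> = \<lfloor>real j * r\<rfloor>)"
    unfolding eventually_at_right_field by blast
  obtain e where "r < e" "e < b" "e \<notin> \<rat>" using ex_irrational_between[OF b(1)] by blast
  then show ?thesis using b(2)[of e] by blast
qed

text \<open>An irrational \<epsilon> close to r keeps all integer parts. The bound on b leaves more
  than b multiples above max \<epsilon> (1 - \<epsilon>), so some admissible l has exactly b of them
  above it. The bound on the fractional part puts the m-th multiple below that l, as a starting
  point.\<close>

lemma ex_special_word:
  fixes r :: real
  assumes "0 < r" "r < 1" "r \<noteq> 1 / 2" "frac (real (n + b + 1) * r) < max r (1 - r)"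
    and "real b + 1 \<le> real (n + b + 1) * min r (1 - r)"
  shows "\<exists>w \<epsilon> l x. w \<in> special (- \<rat>) n \<and> count_list w B = b \<and> adm \<epsilon> l \<and> follows \<epsilon> l w x \<and> final \<epsilon> w x = \<epsilon> \<and>
    (\<forall>j \<le> n + b + 1. \<lfloor>real j * \<epsilon>\<rfloor> = \<lfloor>real j * r\<rfloor>)"
proof -
  define m where "m = n + b + 1"
  obtain \<epsilon> where e: "\<epsilon> \<notin> \<rat>" "r < \<epsilon>" "\<epsilon> < 1" "r < 1 / 2 \<Longrightarrow> \<epsilon> < 1 / 2"
    "frac (real m * \<epsilon>) < max \<epsilon> (1 - \<epsilon>)" "\<And>j. j \<le> m \<Longrightarrow> \<lfloor>real j * \<epsilon>\<rfloor> = \<lfloor>real j * r\<rfloor>"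
    using ex_irrational_right[OF assms(4,1-3)] unfolding m_def by blast
  define c where "c = max \<epsilon> (1 - \<epsilon>)"
  define f where "f j = frac (real j * \<epsilon>)" for j :: nat
  have e0: "0 < \<epsilon>" using e assms by simp
  have over: "card (over \<epsilon> l m) = card {j \<in> {1..m}. l \<le> f j}" for l by (simp add: over_def f_def)
  \<comment> \<open>On each side of 1 / 2, \<open>c\<close> is one of the two thresholds for which
    the count is known exactly.\<close>
  have "b < card (over \<epsilon> c m)"
  proof (cases "r < 1 / 2")
    case True
    then have "c = 1 - \<epsilon>" using e(4) by (simp add: c_def)
    have "real b + 1 \<le> real m * r" using assms(5) True by (simp add: m_def)
    also have "\<dots> \<le> real (Suc m) * \<epsilon>" using e assms by (intro mult_mono) auto
    finally have "int b + 1 \<le> \<lfloor>real (Suc m) * \<epsilon>\<rfloor>" by (simp add: le_floor_iff)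
    then show ?thesis using card_over_1_minus[OF e0 e(3), of m] \<open>c = 1 - \<epsilon>\<close> by simp
  next
    case False
    then have "c = \<epsilon>" using e(2) by (simp add: c_def)
    have "real b + 1 \<le> real m - real m * r" using assms(5) False by (simp add: m_def right_diff_distrib)
    then have "\<lfloor>real m * r\<rfloor> \<le> int m - int b - 1" by linarith
    then show ?thesis using card_over_self[OF e0 e(3), of m] e(6)[of m] \<open>c = \<epsilon>\<close> by simp
  qed
  then have "\<exists>l. c < l \<and> l < 1 \<and> (\<forall>j\<in>{1..m}. f j \<noteq> l) \<and> card {j \<in> {1..m}. l \<le> f j} = b"
    using e e0 by (intro ex_threshold) (auto simp: over inj_on_def f_def c_def frac_lt_1 dest: frac_mult_inj)
  then obtain l where l: "c < l" "l < 1" "\<And>j. 1 \<le> j \<Longrightarrow> j \<le> m \<Longrightarrow> f j \<noteq> l" "card (over \<epsilon> l m) = b"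
    unfolding over by auto
  have a: "adm \<epsilon> l" using l by (simp add: adm_def c_def)
  have fl: "f m < l" using order.strict_trans[OF e(5)[folded c_def] l(1)] by (simp add: f_def)
  obtain w where w: "sfollows \<epsilon> l w (f m)" "final \<epsilon> w (f m) = \<epsilon>" "Suc (wts w) = m"
    using ex_word_to_discontinuity[OF a e(1) l(3)[unfolded f_def], of m] fl unfolding f_def m_def by auto
  have "count_list w B = b"
    using card_over_hit[OF a sfollows_imp_follows[OF w(1)] w(2)] w(3) l(4) by simp
  then have "length w = n" using w(3) by (simp add: m_def wts_eq_length)
  have "f m \<noteq> 0"
    using irrational_mult_not_int[OF e(1), of m "of_int \<lfloor>real m * \<epsilon>\<rfloor>"] by (auto simp: f_def frac_def m_def)
  moreover have "f m \<ge> 0" by (simp add: f_def)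
  ultimately have "w \<in> special (- \<rat>) n"
    using e(1) by (intro special_of_sfollows[OF _ a _ fl w(1,2) \<open>length w = n\<close>]) auto
  then show ?thesis
    using \<open>count_list w B = b\<close> a sfollows_imp_follows[OF w(1)] w(2) e(6) unfolding m_def by blast
qed

text \<open>At j = q' the second integer part is p' itself, so equality gives p' / q' \<le> p / q; j
  = q gives the converse.\<close>

lemma fraction_eqI:
  assumes "\<And>j. 1 \<le> j \<Longrightarrow> j \<le> m \<Longrightarrow> \<lfloor>real j * (real p / real q)\<rfloor> = \<lfloor>real j * (real p' / real q')\<rfloor>"
    and "1 \<le> q" "q \<le> m" "1 \<le> q'" "q' \<le> m"
  shows "real p / real q = real p' / real q'"
proof -
  have *: "real p' / real q' \<le> real p / real q"
    if "\<lfloor>real q' * (real p / real q)\<rfloor> = \<lfloor>real q' * (real p' / real q')\<rfloor>" "1 \<le> q'" for p q p' q' :: nat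
  proof -
    have "real q' * (real p' / real q') = of_int (int p')" using that(2) by simp
    then have "\<lfloor>real q' * (real p / real q)\<rfloor> = int p'" using that(1) by simp
    then have "real p' \<le> real q' * (real p / real q)" by linarith
    then show ?thesis using that(2) by (simp add: field_simps)
  qed
  show ?thesis using *[of q' p q p'] *[of q p' q' p] assms by fastforce
qed


text \<open>The slope p / q ranges over [a / Q, 1 / 2). The bound \<open>X\<close> is separate from
  \<open>Q\<close> because dividing out a common divisor d shrinks the denominators but keeps the
  slope.\<close>

definition fracs :: "nat \<Rightarrow> nat \<Rightarrow> nat \<Rightarrow> (nat \<times> nat) set" where
  "fracs Q a X = {(p, q). 1 \<le> q \<and> q \<le> X \<and> 2 * p < q \<and> a * q \<le> Q * p}"

definition coprime_fracs :: "nat \<Rightarrow> nat \<Rightarrow> (nat \<times> nat) set" where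
  "coprime_fracs Q a = {(p, q) \<in> fracs Q a Q. coprime p q}"

text \<open>Of \<open>p / q\<close> and \<open>1 - p / q\<close>, this selects one whose \<open>m\<close>-th multiple has fractional part at most
  \<open>1 / 2\<close>, so that the backward orbit of length \<open>m\<close> ends below every admissible \<open>l\<close>.\<close>

definition fold_num :: "nat \<Rightarrow> nat \<Rightarrow> nat \<Rightarrow> nat" where
  "fold_num m p q = (if frac (real m * (real p / real q)) \<le> 1 / 2 then p else q - p)"

text \<open>Since p / q < 1 / 2, the larger of r and 1 - r exceeds 1 / 2, and passing from r to 1 -
  r turns a nonzero fractional part y of the m-th multiple into 1 - y. The last claim recovers p, so
  folding is injective.\<close>

lemma fold_num_props:
  assumes "(p, q) \<in> coprime_fracs (n + b + 1) (b + 1)"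
  defines "r \<equiv> real (fold_num (n + b + 1) p q) / real q"
  shows "0 < r" "r < 1" "r \<noteq> 1 / 2" "frac (real (n + b + 1) * r) < max r (1 - r)"
    "real b + 1 \<le> real (n + b + 1) * min r (1 - r)"
    "coprime (fold_num (n + b + 1) p q) q"
    "p = min (fold_num (n + b + 1) p q) (q - fold_num (n + b + 1) p q)"
proof -
  define m where "m = n + b + 1"
  have *: "1 \<le> q" "q \<le> m" "2 * p < q" "(b + 1) * q \<le> m * p" "coprime p q"
    using assms(1) by (auto simp: coprime_fracs_def fracs_def m_def)
  then have p0: "0 < p" by (cases p) auto
  define t where "t = real p / real q"
  have t: "0 < t" "t < 1 / 2" using * p0 by (auto simp: t_def field_simps)
  have "real ((b + 1) * q) \<le> real (m * p)" using *(4) of_nat_le_iff by blast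
  then have bt: "real b + 1 \<le> real m * t" using *(1) by (simp add: t_def field_simps)
  have r: "r = (if frac (real m * t) \<le> 1 / 2 then t else 1 - t)"
  proof -
    have "r = real (fold_num m p q) / real q" by (simp only: r_def m_def)
    moreover have "real (q - p) / real q = 1 - t"
      using * by (simp add: t_def of_nat_diff diff_divide_distrib)
    ultimately show ?thesis unfolding fold_num_def by (simp add: t_def)
  qed
  then show "0 < r" "r < 1" "r \<noteq> 1 / 2" using t by (auto split: if_splits)
  have "min r (1 - r) = t" using r t by (auto split: if_splits)
  then show "real b + 1 \<le> real (n + b + 1) * min r (1 - r)" using bt by (simp add: m_def)
  have mx: "max r (1 - r) > 1 / 2" using r t by (auto split: if_splits)
  have "frac (real m * r) \<le> 1 / 2"
  proof (cases "frac (real m * t) \<le> 1 / 2")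
    case False
    then have "frac (real m * t) \<noteq> 0" by linarith
    then have "real m * t \<notin> \<int>" unfolding frac_eq_0_iff .
    then have "frac (- (real m * t)) = 1 - frac (real m * t)" by (simp add: frac_neg)
    moreover have "frac (real m * (1 - t)) = frac (- (real m * t))"
    proof -
      have "real m * (1 - t) = - (real m * t) + of_int (int m)" by (simp add: algebra_simps)
      then show ?thesis unfolding frac_def by (simp only: floor_add_int[symmetric] of_int_add)
    qed
    ultimately show ?thesis using False r by simp
  qed (use r in auto)
  then show "frac (real (n + b + 1) * r) < max r (1 - r)" using mx by (simp add: m_def)
  have "coprime (q - p) q"
  proof (rule coprimeI)
    fix c assume "c dvd q - p" "c dvd q"
    then have "c dvd p" using *(3) by (intro dvd_diffD1[of c q p]) auto
    then show "is_unit c" using coprime_common_divisor[OF *(5)] \<open>c dvd q\<close> by blast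
  qed
  then show "coprime (fold_num (n + b + 1) p q) q" using *(5) by (simp add: fold_num_def)
  show "p = min (fold_num (n + b + 1) p q) (q - fold_num (n + b + 1) p q)"
    using *(3) by (auto simp: fold_num_def)
qed

lemma length_special: "w \<in> special E n \<Longrightarrow> length w = n"
  by (auto simp: special_def ext_iff)

lemma finite_special: "finite (special E n)"
  by (simp add: special_def finite_ext)

text \<open>Each pair yields a word. Conversely, the word determines the integer parts up to m,
  these determine the fraction r, and its reduced form determines the pair.\<close>

lemma card_coprime_fracs_le:
  "card (coprime_fracs (n + b + 1) (b + 1)) \<le> card {w \<in> special (- \<rat>) n. count_list w B = b}"
proof -
  define m where "m = n + b + 1"
  define r where "r z = real (fold_num m (fst z) (snd z)) / real (snd z)" for z
  define S where "S = coprime_fracs m (b + 1)"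
  define P where "P z w \<longleftrightarrow> (\<exists>\<epsilon> l x. w \<in> special (- \<rat>) n \<and> count_list w B = b \<and> adm \<epsilon> l \<and>
    follows \<epsilon> l w x \<and> final \<epsilon> w x = \<epsilon> \<and> (\<forall>j \<le> m. \<lfloor>real j * \<epsilon>\<rfloor> = \<lfloor>real j * r z\<rfloor>))" for z w
  define F where "F z = (SOME w. P z w)" for z
  have F: "P z (F z)" if "z \<in> S" for z
  proof -
    obtain p q where pq: "z = (p, q)" by (cases z)
    then have "(p, q) \<in> coprime_fracs (n + b + 1) (b + 1)" using that by (simp only: S_def m_def)
    from ex_special_word[OF fold_num_props(1-5)[OF this]]
    have "\<exists>w. P z w" unfolding P_def r_def m_def pq fst_conv snd_conv .
    then show ?thesis unfolding F_def by (rule someI_ex)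
  qed
  have "inj_on F S"
  proof (rule inj_onI)
    fix z z' assume z: "z \<in> S" "z' \<in> S" "F z = F z'"
    obtain p q p' q' where pq: "z = (p, q)" "z' = (p', q')" by (cases z; cases z')
    obtain \<epsilon> l x where 1: "F z \<in> special (- \<rat>) n" "count_list (F z) B = b" "adm \<epsilon> l" "follows \<epsilon> l (F z) x"
      "final \<epsilon> (F z) x = \<epsilon>" "\<forall>j \<le> m. \<lfloor>real j * \<epsilon>\<rfloor> = \<lfloor>real j * r z\<rfloor>"
      using F[OF z(1)] unfolding P_def by blast
    obtain \<epsilon>' l' x' where 2: "adm \<epsilon>' l'" "follows \<epsilon>' l' (F z) x'"
      "final \<epsilon>' (F z) x' = \<epsilon>'" "\<forall>j \<le> m. \<lfloor>real j * \<epsilon>'\<rfloor> = \<lfloor>real j * r z'\<rfloor>"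
      using F[OF z(2)] unfolding P_def z(3) by blast
    have "Suc (wts (F z)) = m" using length_special[OF 1(1)] 1(2) by (simp add: wts_eq_length m_def)
    then have fl: "\<lfloor>real j * r z\<rfloor> = \<lfloor>real j * r z'\<rfloor>" if "1 \<le> j" "j \<le> m" for j
      using hit_floor_cong[OF 1(3-5) 2(1-3) that(1)] 1(6) 2(4) that by metis
    define g where "g = fold_num m p q"
    define g' where "g' = fold_num m p' q'"
    have q: "1 \<le> q" "q \<le> m" "1 \<le> q'" "q' \<le> m"
      using z(1,2) pq by (auto simp: S_def coprime_fracs_def fracs_def)
    have "real g / real q = real g' / real q'"
      by (rule fraction_eqI[OF _ q]) (use fl in \<open>simp only: r_def pq fst_conv snd_conv g_def g'_def\<close>)
    then have "real (g * q') = real (g' * q)" using q by (simp add: field_simps)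
    then have eq: "g * q' = g' * q" by (simp only: of_nat_eq_iff)
    have g: "coprime g q" "p = min g (q - g)" "coprime g' q'" "p' = min g' (q' - g')"
      using fold_num_props(6,7)[of p q n b] fold_num_props(6,7)[of p' q' n b] z(1,2)
      unfolding pq S_def m_def g_def g'_def by blast+
    have "g = g'" "q = q'" using coprime_crossproduct_nat[OF g(1,3)] eq by blast+
    then show "z = z'" using g pq by simp
  qed
  moreover have "F ` S \<subseteq> {w \<in> special (- \<rat>) n. count_list w B = b}"
    using F by (auto simp: P_def)
  moreover have "finite {w \<in> special (- \<rat>) n. count_list w B = b}"
    by (simp add: finite_special)
  ultimately show ?thesis unfolding S_def m_def by (rule card_inj_on_le)
qed

text \<open>Words with different b are different. With Q = n + b + 1 and a = b + 1, the range b < n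
  is the one where a / Q \<le> 1 / 2.\<close>

lemma card_special_ge:
  "(\<Sum>b<n. card (coprime_fracs (n + b + 1) (b + 1))) \<le> card (special (- \<rat>) n)"
proof -
  have "(\<Sum>b<n. card (coprime_fracs (n + b + 1) (b + 1))) \<le>
      (\<Sum>b<n. card {w \<in> special (- \<rat>) n. count_list w B = b})"
    by (intro sum_mono card_coprime_fracs_le)
  also have "\<dots> = card (\<Union>b<n. {w \<in> special (- \<rat>) n. count_list w B = b})"
    using finite_special by (subst card_UN_disjoint) auto
  also have "\<dots> \<le> card (special (- \<rat>) n)" using finite_special by (intro card_mono) auto
  finally show ?thesis .
qed

section \<open>Counting coprime pairs\<close>

text \<open>For fixed q the numerators are the integers of a half-open interval of length s *
  q.\<close>

lemma fracs_row:
  assumes "0 < Q" "2 * a \<le> Q" "1 \<le> q"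
  defines "s \<equiv> 1 / 2 - real a / real Q"
  shows "finite {p. 2 * p < q \<and> a * q \<le> Q * p}"
    "real (card {p. 2 * p < q \<and> a * q \<le> Q * p}) \<le> s * real q + 1"
    "s * real q - 1 \<le> real (card {p. 2 * p < q \<and> a * q \<le> Q * p})"
proof -
  define u where "u = real a * real q / real Q"
  define v where "v = real q / 2"
  have iff: "2 * p < q \<and> a * q \<le> Q * p \<longleftrightarrow> u \<le> real p \<and> real p < v" for p
  proof -
    have "a * q \<le> Q * p \<longleftrightarrow> real (a * q) \<le> real (Q * p)" by (simp only: of_nat_le_iff)
    also have "\<dots> \<longleftrightarrow> u \<le> real p" using assms(1) by (simp add: u_def field_simps)
    finally show ?thesis by (auto simp: v_def)
  qed
  have u0: "0 \<le> u" by (simp add: u_def)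
  have uv: "v - u = s * real q" by (simp add: u_def v_def s_def field_simps)
  have "real a / real Q \<le> 1 / 2" using assms by (simp add: field_simps)
  then have "0 \<le> s * real q" by (simp add: s_def)
  then have "u \<le> v" using uv by linarith
  have eq: "{p. 2 * p < q \<and> a * q \<le> Q * p} = {nat \<lceil>u\<rceil>..<nat \<lceil>v\<rceil>}"
    unfolding iff using u0 by (auto simp: nat_le_iff zless_nat_eq_int_zless ceiling_le_iff less_ceiling_iff)
  then show "finite {p. 2 * p < q \<and> a * q \<le> Q * p}" by simp
  have "real (card {p. 2 * p < q \<and> a * q \<le> Q * p}) = of_int (\<lceil>v\<rceil> - \<lceil>u\<rceil>)"
  proof -
    have "0 \<le> \<lceil>u\<rceil>" "\<lceil>u\<rceil> \<le> \<lceil>v\<rceil>" using u0 \<open>u \<le> v\<close> by (simp, intro ceiling_mono)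
    then have "int (nat \<lceil>v\<rceil> - nat \<lceil>u\<rceil>) = \<lceil>v\<rceil> - \<lceil>u\<rceil>" by linarith
    then show ?thesis unfolding eq card_atLeastLessThan by (metis of_int_of_nat_eq)
  qed
  then show "real (card {p. 2 * p < q \<and> a * q \<le> Q * p}) \<le> s * real q + 1"
    "s * real q - 1 \<le> real (card {p. 2 * p < q \<and> a * q \<le> Q * p})"
    unfolding uv[symmetric] by linarith+
qed

lemma card_fracs_bounds:
  assumes "0 < Q" "2 * a \<le> Q"
  defines "s \<equiv> 1 / 2 - real a / real Q"
  shows "finite (fracs Q a X)"
    "real (card (fracs Q a X)) \<le> s * (real X * (real X + 1) / 2) + real X"
    "s * (real X * (real X + 1) / 2) - real X \<le> real (card (fracs Q a X))"
proof -
  let ?R = "\<lambda>q. {p. 2 * p < q \<and> a * q \<le> Q * p}"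
  have eq: "fracs Q a X = prod.swap ` (SIGMA q:{1..X}. ?R q)"
    by (auto simp: fracs_def image_iff)
  have fin: "finite (?R q)" if "q \<in> {1..X}" for q
    using fracs_row(1)[OF assms(1,2), of q] that by simp
  then show "finite (fracs Q a X)" unfolding eq by blast
  have "card (fracs Q a X) = card (SIGMA q:{1..X}. ?R q)"
    unfolding eq by (rule card_image) simp
  also have "\<dots> = (\<Sum>q = 1..X. card (?R q))" using fin by (intro card_SigmaI) auto
  finally have c: "real (card (fracs Q a X)) = (\<Sum>q = 1..X. real (card (?R q)))" by simp
  have sum: "(\<Sum>q = 1..X. s * real q + t) = s * (real X * (real X + 1) / 2) + real X * t" for t
    by (induction X) (auto simp: field_simps)
  have "(\<Sum>q = 1..X. real (card (?R q))) \<le> (\<Sum>q = 1..X. s * real q + 1)"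
    unfolding s_def using fracs_row(2)[OF assms(1,2)] by (intro sum_mono) simp
  then show "real (card (fracs Q a X)) \<le> s * (real X * (real X + 1) / 2) + real X"
    unfolding sum c by simp
  have "(\<Sum>q = 1..X. s * real q + (- 1)) \<le> (\<Sum>q = 1..X. real (card (?R q)))"
    unfolding s_def using fracs_row(3)[OF assms(1,2)] by (intro sum_mono) simp
  then show "s * (real X * (real X + 1) / 2) - real X \<le> real (card (fracs Q a X))"
    unfolding sum c by simp
qed

lemma card_fracs_div_le:
  assumes "0 < Q" "2 * a \<le> Q" "0 < d"
  shows "real (card (fracs Q a (Q div d))) \<le>
    (1 / 2 - real a / real Q) * (real Q)\<^sup>2 / 2 * (1 / (real d)\<^sup>2) + 2 * real Q * (1 / real d)"
proof -
  define s where "s = 1 / 2 - real a / real Q"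
  define X where "X = Q div d"
  define Y where "Y = real Q / real d"
  have s: "0 \<le> s" "s \<le> 1 / 2" using assms by (auto simp: s_def field_simps)
  have X: "real X \<le> Y" unfolding X_def Y_def by (rule of_nat_div_le_of_nat)
  have "real X * (real X + 1) \<le> Y * (Y + 1)" using X by (intro mult_mono) auto
  then have "s * (real X * (real X + 1) / 2) \<le> s * (Y * (Y + 1) / 2)"
    using s by (intro mult_left_mono) auto
  moreover have "s * (Y / 2) \<le> 1 * (Y / 2)" using s by (intro mult_right_mono) (auto simp: Y_def)
  moreover have "s * (Y * (Y + 1) / 2) = s * Y\<^sup>2 / 2 + s * (Y / 2)"
    by (simp add: field_simps power2_eq_square)
  ultimately have "s * (real X * (real X + 1) / 2) + real X \<le> s * Y\<^sup>2 / 2 + 2 * Y"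
    using X of_nat_0_le_iff[of X] by linarith
  then have "real (card (fracs Q a X)) \<le> s * Y\<^sup>2 / 2 + 2 * Y"
    using card_fracs_bounds(2)[OF assms(1,2), of X] unfolding s_def by linarith
  also have "\<dots> = s * (real Q)\<^sup>2 / 2 * (1 / (real d)\<^sup>2) + 2 * real Q * (1 / real d)"
    by (simp add: Y_def power_divide)
  finally show ?thesis unfolding X_def s_def .
qed

text \<open>A common divisor of \<open>p\<close> and \<open>q\<close> is even or an odd number at least 3, and
  \<open>1 / 2\<^sup>2 + (\<Sum>k\<ge>1. 1 / (2 * k + 1)\<^sup>2) \<le> 1 / 2\<close>: less than half of the pairs are lost.\<close>

lemma fracs_minus_coprime:
  "fracs Q a Q - coprime_fracs Q a \<subseteq> (\<Union>d\<in>insert 2 ((\<lambda>k. 2 * k + 1) ` {1..Q}).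
     (\<lambda>(p, q). (d * p, d * q)) ` fracs Q a (Q div d))"
proof
  fix z assume z: "z \<in> fracs Q a Q - coprime_fracs Q a"
  obtain p q where pq: "z = (p, q)" by (cases z)
  have *: "1 \<le> q" "q \<le> Q" "2 * p < q" "a * q \<le> Q * p" "\<not> coprime p q"
    using z by (auto simp: pq fracs_def coprime_fracs_def)
  define g where "g = gcd p q"
  have g: "g dvd p" "g dvd q" "g \<noteq> 1" "g \<noteq> 0" "g \<le> q"
    using *(1,5) by (auto simp: g_def coprime_iff_gcd_eq_1 intro: gcd_le2_nat)
  obtain d where d: "d \<in> insert 2 ((\<lambda>k. 2 * k + 1) ` {1..Q})" "d dvd p" "d dvd q"
  proof (cases "even g")
    case True
    show ?thesis
      by (rule that[of 2]) (use True g in \<open>auto intro: dvd_trans\<close>)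
  next
    case False
    then obtain k where k: "g = 2 * k + 1" by (elim oddE)
    then have "k \<in> {1..Q}" using g(3,5) *(2) by auto
    then show ?thesis by (intro that[of g]) (use k g(1,2) in auto)
  qed
  obtain p' q' where p': "p = d * p'" "q = d * q'" using d(2,3) by (elim dvdE)
  have d0: "d > 0" using d(1) by auto
  have "(p', q') \<in> fracs Q a (Q div d)"
    using *(1-4) d0 unfolding p' fracs_def
    by (auto simp: less_eq_div_iff_mult_less_eq mult.left_commute mult.commute)
  then show "z \<in> (\<Union>d\<in>insert 2 ((\<lambda>k. 2 * k + 1) ` {1..Q}). (\<lambda>(p, q). (d * p, d * q)) ` fracs Q a (Q div d))"
    using d(1) by (intro UN_I[of d]) (auto simp: pq p')
qed

text \<open>The sum telescopes because (2 * k + 1)^2 \<ge> 4 * k * (k + 1).\<close>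

lemma sum_odd_squares_le: "(\<Sum>k = 1..n. 1 / (2 * real k + 1)\<^sup>2) \<le> 1 / 4 - 1 / (4 * (real n + 1))"
proof (induction n)
  case (Suc n)
  have "1 / (2 * real (Suc n) + 1)\<^sup>2 \<le> 1 / (4 * (real n + 1) * (real n + 2))"
    by (intro divide_left_mono mult_pos_pos zero_less_power) (auto simp: power2_eq_square algebra_simps)
  also have "\<dots> = 1 / (4 * (real n + 1)) - 1 / (4 * (real n + 2))"
  proof -
    have *: "1 / (4 * x * y) = 1 / (4 * x) - 1 / (4 * y)" if "x \<noteq> 0" "y \<noteq> 0" "y = x + 1" for x y :: real
      using that by (simp add: field_simps)
    show ?thesis by (rule *) auto
  qed
  finally show ?case using Suc by (simp add: add_ac)
qed simp

lemma sum_odd_inverse_le: "(\<Sum>k = 1..n. 1 / (2 * real k + 1)) \<le> harm n / 2"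
proof -
  have "(\<Sum>k = 1..n. 1 / (2 * real k + 1)) \<le> (\<Sum>k = 1..n. inverse (real k) / 2)"
    by (intro sum_mono) (simp add: field_simps)
  then show ?thesis by (simp add: harm_def sum_divide_distrib)
qed

text \<open>There are about c pairs in all. The divisor 2 removes about c / 4 of them, the odd
  divisors together at most about c / 4, and c / 2 is the main term.\<close>

lemma card_coprime_fracs_ge:
  "((real Q)\<^sup>2 - 2 * real a * real Q) / 8 - 2 * real Q - real Q * harm Q \<le> real (card (coprime_fracs Q a))"
proof (cases "0 < Q \<and> 2 * a \<le> Q")
  case False
  \<comment> \<open>Here Q = 0 or 2 * a > Q, so the claimed lower bound is at most 0.\<close>
  have "real Q * real Q \<le> 2 * real a * real Q" using False by (intro mult_right_mono) auto
  moreover have "0 \<le> real Q * harm Q" by (simp add: harm_nonneg)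
  moreover have "0 \<le> real (card (coprime_fracs Q a))" "0 \<le> real Q" by auto
  ultimately show ?thesis
    using divide_nonpos_pos[of "(real Q)\<^sup>2 - 2 * real a * real Q" 8] unfolding power2_eq_square by linarith
next
  case True
  then have Q: "0 < Q" "2 * a \<le> Q" by auto
  define s where "s = 1 / 2 - real a / real Q"
  define c where "c = s * (real Q)\<^sup>2 / 2"
  define U where "U d = (\<lambda>(p, q). (d * p, d * q)) ` fracs Q a (Q div d)" for d :: nat
  have s: "0 \<le> s" using Q by (auto simp: s_def field_simps)
  have finU: "finite (U d)" for d unfolding U_def using card_fracs_bounds(1)[OF Q] by blast
  have cU: "real (card (U d)) \<le> c * (1 / (real d)\<^sup>2) + 2 * real Q * (1 / real d)" if "0 < d" for d
  proof -
    have "card (U d) \<le> card (fracs Q a (Q div d))"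
      unfolding U_def by (rule card_image_le) (rule card_fracs_bounds(1)[OF Q])
    then show ?thesis using card_fracs_div_le[OF Q that] unfolding c_def s_def by linarith
  qed
  have "card (fracs Q a Q) \<le> card (coprime_fracs Q a \<union> (U 2 \<union> (\<Union>k\<in>{1..Q}. U (2 * k + 1))))"
  proof (rule card_mono)
    have "coprime_fracs Q a \<subseteq> fracs Q a Q" by (auto simp: coprime_fracs_def)
    then show "finite (coprime_fracs Q a \<union> (U 2 \<union> (\<Union>k\<in>{1..Q}. U (2 * k + 1))))"
      using card_fracs_bounds(1)[OF Q, of Q] finU by (auto intro: finite_subset)
    show "fracs Q a Q \<subseteq> coprime_fracs Q a \<union> (U 2 \<union> (\<Union>k\<in>{1..Q}. U (2 * k + 1)))"
      using fracs_minus_coprime[of Q a] unfolding U_def by blast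
  qed
  also have "\<dots> \<le> card (coprime_fracs Q a) + (card (U 2) + (\<Sum>k = 1..Q. card (U (2 * k + 1))))"
    by (intro order_trans[OF card_Un_le] add_mono card_UN_le) auto
  finally have "real (card (fracs Q a Q)) \<le>
      real (card (coprime_fracs Q a)) + (real (card (U 2)) + (\<Sum>k = 1..Q. real (card (U (2 * k + 1)))))"
    by (metis of_nat_add of_nat_le_iff of_nat_sum)
  moreover have "real (card (U 2)) \<le> c / 4 + real Q" using cU[of 2] by simp
  moreover have "(\<Sum>k = 1..Q. real (card (U (2 * k + 1)))) \<le> c / 4 + real Q * harm Q"
  proof -
    have "(\<Sum>k = 1..Q. real (card (U (2 * k + 1)))) \<le>
        (\<Sum>k = 1..Q. c * (1 / (2 * real k + 1)\<^sup>2) + 2 * real Q * (1 / (2 * real k + 1)))"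
      using cU[of "2 * k + 1" for k] by (intro sum_mono) (simp add: add.commute)
    also have "\<dots> = c * (\<Sum>k = 1..Q. 1 / (2 * real k + 1)\<^sup>2) + 2 * real Q * (\<Sum>k = 1..Q. 1 / (2 * real k + 1))"
      by (simp only: sum.distrib sum_distrib_left)
    also have "\<dots> \<le> c * (1 / 4) + 2 * real Q * (harm Q / 2)"
    proof (intro add_mono mult_left_mono)
      show "(\<Sum>k = 1..Q. 1 / (2 * real k + 1)\<^sup>2) \<le> 1 / 4"
        by (rule order_trans[OF sum_odd_squares_le]) simp
    qed (use s sum_odd_inverse_le in \<open>auto simp: c_def\<close>)
    finally show ?thesis by simp
  qed
  moreover have "c - real Q \<le> real (card (fracs Q a Q))"
  proof -
    have "s * (real Q * (real Q + 1) / 2) = c + s * real Q / 2"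
      by (simp add: c_def power2_eq_square field_simps)
    moreover have "0 \<le> s * real Q" using s by simp
    ultimately show ?thesis using card_fracs_bounds(3)[OF Q, of Q, folded s_def] by linarith
  qed
  moreover have "c / 2 = ((real Q)\<^sup>2 - 2 * real a * real Q) / 8"
    using Q by (simp add: c_def s_def field_simps power2_eq_square)
  ultimately show ?thesis by linarith
qed

section \<open>The lower bound\<close>

lemma card_special_lower:
  assumes "n \<le> N"
  shows "real n ^ 3 / 12 - (5 + 2 * harm (2 * N)) * (real N)\<^sup>2 \<le> real (card (special (- \<rat>) n))"
proof -
  define h :: real where "h = harm (2 * N)"
  define e where "e = 2 * real N * (2 + h)"
  have h: "0 \<le> h" by (simp add: h_def harm_nonneg)
  have step: "((real n)\<^sup>2 - (real (Suc b))\<^sup>2) / 8 - e \<le> real (card (coprime_fracs (n + b + 1) (b + 1)))"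
    if "b < n" for b
  proof -
    define Q where "Q = n + b + 1"
    have Q: "Q \<le> 2 * N" using that assms by (simp add: Q_def)
    \<comment> \<open>Both sides are (n + b + 1) * (n - b - 1), as Q = n + (b + 1).\<close>
    have "(real Q)\<^sup>2 - 2 * real (b + 1) * real Q = (real n)\<^sup>2 - (real (Suc b))\<^sup>2"
      by (simp add: Q_def power2_eq_square algebra_simps)
    moreover have "real Q * (2 + harm Q) \<le> e"
      unfolding e_def h_def using Q harm_mono[OF Q, where 'a = real]
      by (intro mult_mono) (auto simp: harm_nonneg)
    ultimately show ?thesis
      using card_coprime_fracs_ge[of Q "b + 1"] unfolding Q_def[symmetric] by (simp add: algebra_simps)
  qed
  have sq: "(\<Sum>b<k. c - (real (Suc b))\<^sup>2 / 8) = real k * c - real k * (real k + 1) * (2 * real k + 1) / 48"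
    for c :: real and k by (induction k) (auto simp: field_simps power2_eq_square)
  have "(\<Sum>b<n. ((real n)\<^sup>2 / 8 - e) - (real (Suc b))\<^sup>2 / 8) \<le>
      (\<Sum>b<n. real (card (coprime_fracs (n + b + 1) (b + 1))))"
    by (intro sum_mono order_trans[OF _ step]) (auto simp: diff_divide_distrib)
  also have "\<dots> \<le> real (card (special (- \<rat>) n))"
    using card_special_ge[of n] by (metis of_nat_le_iff of_nat_sum)
  finally have main: "real n * ((real n)\<^sup>2 / 8 - e) - real n * (real n + 1) * (2 * real n + 1) / 48 \<le>
      real (card (special (- \<rat>) n))" unfolding sq .
  have sq_le: "real n \<le> (real n)\<^sup>2" "(real n)\<^sup>2 \<le> (real N)\<^sup>2"
    using assms by (cases n, auto simp: power2_eq_square intro: mult_mono)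
  have "real n * e \<le> real N * e" using assms h by (intro mult_right_mono) (auto simp: e_def)
  also have "\<dots> = (4 + 2 * h) * (real N)\<^sup>2" by (simp add: e_def power2_eq_square algebra_simps)
  finally have "real n * e \<le> (4 + 2 * h) * (real N)\<^sup>2" .
  moreover have "real n * ((real n)\<^sup>2 / 8 - e) - real n * (real n + 1) * (2 * real n + 1) / 48 =
      real n ^ 3 / 12 - real n * e - (real n)\<^sup>2 / 16 - real n / 48"
    by (simp add: field_simps power2_eq_square power3_eq_cube)
  moreover have "(5 + 2 * h) * (real N)\<^sup>2 = (4 + 2 * h) * (real N)\<^sup>2 + (real N)\<^sup>2"
    by (simp add: algebra_simps)
  ultimately show ?thesis using main sq_le unfolding h_def by linarith
qed

lemma card_lang_lower:
  "real N ^ 4 / 24 - (11 + 4 * harm (2 * N)) * real N ^ 3 \<le> real (card (lang (- \<rat>) N))"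
proof -
  define K :: real where "K = 2 * (5 + 2 * harm (2 * N)) * (real N)\<^sup>2"
  have minus: "1 - \<epsilon> \<in> - \<rat>" if "\<epsilon> \<in> - \<rat>" for \<epsilon> :: real
  proof
    assume "1 - \<epsilon> \<in> \<rat>"
    from Rats_diff[OF Rats_1 this] show False using that by simp
  qed
  \<comment> \<open>\<open>K\<close> is fixed by N, so the errors add up linearly in n. The term n^3
    / 12 cancels the quadratic part of the increment of n^4 / 24.\<close>
  have "real n ^ 4 / 24 - real n ^ 3 / 12 - real n * K \<le> real (card (lang (- \<rat>) n))" if "n \<le> N" for n
    using that
  proof (induction n)
    case (Suc n)
    have "real (card (lang (- \<rat>) n)) + 2 * real (card (special (- \<rat>) n)) \<le> real (card (lang (- \<rat>) (Suc n)))"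
      using card_lang_Suc_ge[of "- \<rat>" n, OF minus] by linarith
    moreover have "real n ^ 3 / 6 - K \<le> 2 * real (card (special (- \<rat>) n))"
      using card_special_lower[of n N] Suc.prems by (simp add: K_def algebra_simps)
    moreover have "real (Suc n) ^ 4 / 24 - real (Suc n) ^ 3 / 12 \<le> real n ^ 4 / 24 - real n ^ 3 / 12 + real n ^ 3 / 6"
      by (simp add: field_simps power4_eq_xxxx power3_eq_cube)
    moreover have "real (Suc n) * K = real n * K + K" by (simp add: algebra_simps)
    ultimately show ?case using Suc.IH Suc.prems by linarith
  qed simp
  from this[OF order.refl] have "real N ^ 4 / 24 - real N ^ 3 / 12 - real N * K \<le> real (card (lang (- \<rat>) N))" .
  moreover have "(11 + 4 * harm (2 * N)) * real N ^ 3 = real N * K + real N ^ 3"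
    by (simp add: K_def power2_eq_square power3_eq_cube algebra_simps)
  moreover have "0 \<le> real N ^ 3" by simp
  ultimately show ?thesis by linarith
qed

section \<open>Absorbing the harmonic sum into a power of N\<close>

lemma harm_le_ln: "1 \<le> n \<Longrightarrow> harm n \<le> 1 + ln (real n)"
  using decseqD[OF decseq_harm_diff_ln, of 0 "n - 1"] by (simp add: harm_expand)

lemma harm_le_powr:
  fixes \<delta> :: real
  assumes "\<delta> > 0" "1 \<le> N"
  shows "harm (2 * N) \<le> (2 + 1 / \<delta>) * real N powr \<delta>"
proof -
  have "ln (2 * real N) = ln 2 + ln (real N)" using assms by (simp add: ln_mult)
  moreover have "ln 2 \<le> (1 :: real)" using ln_le_minus_one[of 2] by simp
  moreover have "ln (real N) \<le> real N powr \<delta> / \<delta>" using assms by (intro ln_powr_bound) auto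
  moreover have "1 \<le> real N powr \<delta>" using assms by (simp add: ge_one_powr_ge_zero)
  moreover have "harm (2 * N) \<le> 1 + ln (2 * real N)" using harm_le_ln[of "2 * N"] assms by simp
  ultimately show ?thesis by (simp add: algebra_simps)
qed

theorem mainTheorem1:
  "\<forall>\<delta>::real. \<delta> > 0 \<longrightarrow> (\<exists>K::real. K > 0 \<and> (\<forall>N::nat. N \<ge> 1 \<longrightarrow>
      1 / (3 * pi\<^sup>2) * real N ^ 4 - K * real N powr (3 + \<delta>) \<le> real (card (iet3 N)) \<and>
      real (card (iet3 N)) \<le> 2 / pi\<^sup>2 * real N ^ 4 + K * real N powr (3 + \<delta>)))"
proof (intro allI impI)
  fix \<delta> :: real
  assume \<delta>: "\<delta> > 0"
  \<comment> \<open>The lower bound needs 11 + 4 * (2 + 1 / \<delta>) = 19 + 4 / \<delta>, by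
    \<open>harm_le_powr\<close>; the upper bound needs 22 + 1 = 23.\<close>
  define K where "K = 23 + 4 / \<delta>"
  show "\<exists>K::real. K > 0 \<and> (\<forall>N::nat. N \<ge> 1 \<longrightarrow>
      1 / (3 * pi\<^sup>2) * real N ^ 4 - K * real N powr (3 + \<delta>) \<le> real (card (iet3 N)) \<and>
      real (card (iet3 N)) \<le> 2 / pi\<^sup>2 * real N ^ 4 + K * real N powr (3 + \<delta>))"
  proof (intro exI[of _ K] conjI allI impI)
    show "K > 0" using \<delta> by (simp add: K_def add_pos_pos)
    fix N :: nat
    assume N: "N \<ge> 1"
    define P where "P = real N powr \<delta>"
    have P: "1 \<le> P" using N \<delta> by (simp add: P_def ge_one_powr_ge_zero)
    have N3: "real N powr (3 + \<delta>) = real N ^ 3 * P"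
      using N by (simp add: P_def powr_add)
    have "3 * 3 \<le> pi * pi" "pi * pi \<le> (16 / 5) * (16 / 5)"
      using pi_approx by (intro mult_mono; simp)+
    then have pi2: "8 \<le> pi\<^sup>2" "pi\<^sup>2 \<le> 12" by (auto simp: power2_eq_square)
    have "1 / (3 * pi\<^sup>2) * real N ^ 4 \<le> 1 / 24 * real N ^ 4"
      using pi2 by (intro mult_right_mono divide_left_mono) auto
    moreover have "11 + 4 * harm (2 * N) \<le> K * P"
      using harm_le_powr[OF \<delta> N] P by (simp add: K_def P_def algebra_simps)
    then have "(11 + 4 * harm (2 * N)) * real N ^ 3 \<le> K * P * real N ^ 3"
      by (intro mult_right_mono) auto
    ultimately show "1 / (3 * pi\<^sup>2) * real N ^ 4 - K * real N powr (3 + \<delta>) \<le> real (card (iet3 N))"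
      using card_lang_lower[of N] unfolding iet3_eq_lang N3 by (simp add: mult_ac)
    have "finite (lang UNIV N)" by (rule finite_lang)
    moreover have "lang (- \<rat>) N \<subseteq> lang UNIV N" by (auto simp: lang_def)
    ultimately have "card (iet3 N) \<le> card (lang UNIV N)" unfolding iet3_eq_lang by (rule card_mono)
    moreover have "1 / 6 * real N ^ 4 \<le> 2 / pi\<^sup>2 * real N ^ 4"
      using pi2 by (intro mult_right_mono) (auto simp: field_simps)
    moreover have "22 * real N ^ 3 + 1 \<le> K * (real N ^ 3 * P)"
    proof -
      have "1 \<le> real N ^ 3" using N by simp
      moreover have "23 * real N ^ 3 \<le> K * P * real N ^ 3"
      proof (rule mult_right_mono)
        have "23 * 1 \<le> K * P" using P \<delta> by (intro mult_mono) (auto simp: K_def)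
        then show "23 \<le> K * P" by simp
      qed simp
      ultimately show ?thesis by (simp add: mult_ac)
    qed
    ultimately show "real (card (iet3 N)) \<le> 2 / pi\<^sup>2 * real N ^ 4 + K * real N powr (3 + \<delta>)"
      using card_lang_UNIV_le[of N] unfolding N3 by linarith
  qed
qed

end
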